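(* Let $\mathcal{P}$ be a polyomino such that $\mathcal{M}$ is a reduced Gröbner basis of $I_{\mathcal{P}}$ with respect to $<^i_{\mathrm{grevlex}}$ for some $i\in\mathcal{O}=\{1,3,5,7\}$ (respectively, for some $i\in\mathcal{E}=\{2,4,6,8\}$). Suppose that for every $v\in V(\mathcal{P})$ there exists $k_v\in\mathcal{O}$ (respectively, $k_v\in\mathcal{E}$) such that $v$ does not satisfy the condition $\pi_{k_v}$. Then: (1) $\mathcal{M}$ forms a reduced Gröbner basis of $I_{\mathcal{P}}$ with respect to $<_v^{k_v}$, for all $v\in V(\mathcal{P})$; (2) $I_{\mathcal{P}}$ is a prime ideal.
   Context: **Polyominoes.** For $a=(i,j),b=(k,\ell)\in\mathbb{N}^2$ with $i\le k$, $j\le \ell$, the interval $[a,b]$ is $\{(r,s)\in\mathbb{N}^2: i\le r\le k,\ j\le s\le \ell\}$. It is proper if $i<k$ and $j<\ell$; then $a$ (lower left) and $b$ (upper right) are its diagonal corners, and $c=(i,\ell)$ (upper left) and $d=(k,j)$ (lower right) are its anti-diagonal corners. A cell is an interval $C=[a,a+(1,1)]$; its vertex set $V(C)$ consists of its four corners, and its edges are $\{a,a+(1,0)\}$, $\{a,a+(0,1)\}$, $\{a+(1,0),a+(1,1)\}$, $\{a+(0,1),a+(1,1)\}$. A polyomino is a finite collection $\mathcal{P}$ of cells such that any two cells $C,D$ of $\mathcal{P}$ are connected by a sequence of cells $C=C_1,\dots,C_m=D$ of $\mathcal{P}$ with $C_t\cap C_{t+1}$ an edge of $C_t$ for every $t<m$.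 Put $V(\mathcal{P})=\bigcup_{C\in\mathcal{P}}V(C)$. A proper interval $[a,b]$ is an inner interval of $\mathcal{P}$ if all cells contained in $[a,b]$ belong to $\mathcal{P}$. **Polyomino ideal.** Let $\mathbb{K}$ be a field and $S=\mathbb{K}[x_v\mid v\in V(\mathcal{P})]$. $\mathcal{M}$ is the set of all inner 2-minors $x_ax_b-x_cx_d$, where $[a,b]$ ranges over the inner intervals of $\mathcal{P}$ and $c,d$ are the anti-diagonal corners of $[a,b]$; $I_{\mathcal{P}}\subset S$ is the ideal generated by $\mathcal{M}$. When speaking of reduced Gröbner bases, elements of $\mathcal{M}$ are taken up to sign so that leading coefficients are $1$. **Orders.** For $a=(a_1,a_2)$, $b=(b_1,b_2)$ in $V(\mathcal{P})$ define total orders $<^1,\dots,<^8$: - $a<^1b$ iff $a_1<b_1$, or $a_1=b_1$ and $a_2>b_2$; - $a<^2b$ iff $a_1>b_1$, or $a_1=b_1$ and $a_2>b_2$; - $a<^3b$ iff $a_1>b_1$, or $a_1=b_1$ and $a_2<b_2$; - $a<^4b$ iff $a_1<b_1$, or $a_1=b_1$ and $a_2<b_2$; - $a<^5b$ iff $a_2<b_2$, or $a_2=b_2$ and $a_1>b_1$; - $a<^6b$ iff $a_2<b_2$, or $a_2=b_2$ and $a_1<b_1$; - $a<^7b$ iff $a_2>b_2$, or $a_2=b_2$ and $a_1<b_1$; - $a<^8b$ iff $a_2>b_2$, or $a_2=b_2$ and $a_1>b_1$. $<^i_{\mathrm{grevlex}}$ is the graded reverse lexicographic monomial order on $S$ whose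 variables are ordered by $x_a<x_b$ iff $a<^ib$. If $V(\mathcal{P})=\{v_1,\dots,v_n\}$ with $v_1<^i\cdots<^iv_n$ and $v=v_k$, then $<^i_v$ is the graded reverse lexicographic monomial order on $S$ with variables ordered by $x_{v_k}<x_{v_{k+1}}<\cdots<x_{v_n}<x_{v_1}<\cdots<x_{v_{k-1}}$. **Conditions $\pi_i$.** For integers $x_0<x_1<x_2$ and $y_0<y_1<y_2$ consider the four intervals $LL=[(x_0,y_0),(x_1,y_1)]$, $LR=[(x_1,y_0),(x_2,y_1)]$, $UL=[(x_0,y_1),(x_1,y_2)]$, $UR=[(x_1,y_1),(x_2,y_2)]$. Say that $X\in\{LL,LR,UL,UR\}$ is the missing one if $X$ is not an inner interval of $\mathcal{P}$ while the three others are inner intervals of $\mathcal{P}$. A vertex $v\in V(\mathcal{P})$ satisfies $\pi_i$ if there are $x_0<x_1<x_2$, $y_0<y_1<y_2$ for which at least one of the corresponding (I), (II) holds: - $\pi_1$: (I) $LR$ missing, $v=(x_0,y_1)$; (II) $LL$ missing, $v=(x_1,y_1)$. - $\pi_2$: (I) $LL$ missing, $v=(x_2,y_1)$; (II) $LR$ missing, $v=(x_1,y_1)$. - $\pi_3$: (I) $UL$ missing, $v=(x_2,y_1)$; (II) $UR$ missing, $v=(x_1,y_1)$. - $\pi_4$: (I) $UR$ missing, $v=(x_0,y_1)$; (II) $UL$ missing, $v=(x_1,y_1)$. - $\pi_5$: (I) $UL$ missing, $v=(x_1,y_0)$; (II) $LL$ missing, $v=(x_1,y_1)$. - $\pi_6$: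 (I) $UR$ missing, $v=(x_1,y_0)$; (II) $LR$ missing, $v=(x_1,y_1)$. - $\pi_7$: (I) $LR$ missing, $v=(x_1,y_2)$; (II) $UR$ missing, $v=(x_1,y_1)$. - $\pi_8$: (I) $LL$ missing, $v=(x_1,y_2)$; (II) $UL$ missing, $v=(x_1,y_1)$. *)

theory Defs
  imports "HOL-Library.Poly_Mapping" "HOL-Algebra.Ideal"
begin

section \<open>Polyominoes\<close>

type_synonym vertex = "nat \<times> nat"

definition interval :: "vertex \<Rightarrow> vertex \<Rightarrow> vertex set" where
  "interval a b = {fst a..fst b} \<times> {snd a..snd b}"

definition proper :: "vertex \<Rightarrow> vertex \<Rightarrow> bool" where
  "proper a b \<longleftrightarrow> fst a < fst b \<and> snd a < snd b"

definition cell :: "vertex \<Rightarrow> vertex set" where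
  "cell a = interval a (fst a + 1, snd a + 1)"

definition is_cell :: "vertex set \<Rightarrow> bool" where
  "is_cell C \<longleftrightarrow> (\<exists>a. C = cell a)"

definition edges :: "vertex set \<Rightarrow> vertex set set" where
  "edges C = {e. \<exists>i j. C = cell (i, j) \<and>
     e \<in> {{(i, j), (i + 1, j)}, {(i, j), (i, j + 1)},
          {(i + 1, j), (i + 1, j + 1)}, {(i, j + 1), (i + 1, j + 1)}}}"

definition polyomino :: "vertex set set \<Rightarrow> bool" where
  "polyomino P \<longleftrightarrow> finite P \<and> (\<forall>C\<in>P. is_cell C) \<and>
     (\<forall>C\<in>P. \<forall>D\<in>P. \<exists>Cs. Cs \<noteq> [] \<and> set Cs \<subseteq> P \<and> hd Cs = C \<and> last Cs = D \<and>
        (\<forall>t. Suc t < length Cs \<longrightarrow> Cs ! t \<inter> Cs ! Suc t \<in> edges (Cs ! t)))"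

text \<open>A cell is a subset of the lattice consisting of exactly its four corners, so the vertex
  set of a collection of cells is simply its union.\<close>

lemma cell_eq_corners: "cell (i, j) = {(i, j), (i + 1, j), (i, j + 1), (i + 1, j + 1)}"
  by (auto simp: cell_def interval_def)

definition vertices :: "vertex set set \<Rightarrow> vertex set" where
  "vertices P = \<Union>P"

definition inner_interval :: "vertex set set \<Rightarrow> vertex \<Rightarrow> vertex \<Rightarrow> bool" where
  "inner_interval P a b \<longleftrightarrow> proper a b \<and> (\<forall>C. is_cell C \<and> C \<subseteq> interval a b \<longrightarrow> C \<in> P)"


section \<open>Polynomials, Groebner bases, and the polyomino ideal\<close>

type_synonym monomial = "vertex \<Rightarrow>\<^sub>0 nat"
type_synonym 'k pol = "monomial \<Rightarrow>\<^sub>0 'k"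

text \<open>The polynomial ring over the field \<open>'k\<close> in the variables indexed by \<open>V\<close>.  It is realised
  inside the polynomials in all variables \<open>vertex\<close>, as those that only involve variables from
  \<open>V\<close>; ideals are always taken with respect to this ring.\<close>

definition poly_ring :: "vertex set \<Rightarrow> ('k::field) pol ring" where
  "poly_ring V = \<lparr>carrier = {p. \<forall>m\<in>Poly_Mapping.keys p. Poly_Mapping.keys m \<subseteq> V},
     mult = (*), one = 1, zero = 0, add = (+)\<rparr>"

lemma cring_poly_ring: "cring (poly_ring V :: ('k::field) pol ring)"
proof -
  let ?R = "poly_ring V :: 'k pol ring"
  have neg: "- p \<in> carrier ?R" if "p \<in> carrier ?R" for p
    using that by (auto simp: poly_ring_def)
  have add: "p + q \<in> carrier ?R" if "p \<in> carrier ?R" "q \<in> carrier ?R" for p q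
    using that Poly_Mapping.keys_add[of p q] by (fastforce simp: poly_ring_def)
  have mult: "p * q \<in> carrier ?R" if p: "p \<in> carrier ?R" and q: "q \<in> carrier ?R" for p q
  proof -
    have "Poly_Mapping.keys m \<subseteq> V" if m: "m \<in> Poly_Mapping.keys (p * q)" for m
    proof -
      obtain a b where "m = a + b" "a \<in> Poly_Mapping.keys p" "b \<in> Poly_Mapping.keys q"
        using m Poly_Mapping.keys_mult[of p q] by blast
      with p q Poly_Mapping.keys_add[of a b] show ?thesis
        by (fastforce simp: poly_ring_def)
    qed
    then show ?thesis by (auto simp: poly_ring_def)
  qed
  have "abelian_group ?R"
  proof (rule abelian_groupI)
    fix p assume "p \<in> carrier ?R"
    then show "\<exists>q\<in>carrier ?R. q \<oplus>\<^bsub>?R\<^esub> p = \<zero>\<^bsub>?R\<^esub>"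
      using neg[of p] by (intro bexI[of _ "- p"]) (simp_all add: poly_ring_def)
  next
    fix p q assume "p \<in> carrier ?R" "q \<in> carrier ?R"
    then show "p \<oplus>\<^bsub>?R\<^esub> q \<in> carrier ?R"
      using add[of p q] by (simp add: poly_ring_def)
  qed (simp_all add: poly_ring_def ac_simps)
  moreover have "comm_monoid ?R"
  proof (rule comm_monoidI)
    fix p q assume "p \<in> carrier ?R" "q \<in> carrier ?R"
    then show "p \<otimes>\<^bsub>?R\<^esub> q \<in> carrier ?R"
      using mult[of p q] by (simp add: poly_ring_def)
  qed (simp_all add: poly_ring_def ac_simps)
  ultimately show ?thesis
    by (rule cringI) (simp add: poly_ring_def distrib_right)
qed

definition monom_pol :: "monomial \<Rightarrow> ('k::field) pol" where
  "monom_pol m = Poly_Mapping.single m 1"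

definition var :: "vertex \<Rightarrow> ('k::field) pol" where
  "var v = monom_pol (Poly_Mapping.single v 1)"

text \<open>Here \<open>(fst a, snd b)\<close> and \<open>(fst b, snd a)\<close> are the anti-diagonal corners.\<close>

definition minor :: "vertex \<Rightarrow> vertex \<Rightarrow> ('k::field) pol" where
  "minor a b = var a * var b - var (fst a, snd b) * var (fst b, snd a)"

definition inner_minors :: "vertex set set \<Rightarrow> ('k::field) pol set" where
  "inner_minors P = {minor a b | a b. inner_interval P a b}"

definition polyomino_ideal :: "vertex set set \<Rightarrow> ('k::field) pol set" where
  "polyomino_ideal P = Idl\<^bsub>poly_ring (vertices P)\<^esub> (inner_minors P)"

text \<open>In what follows a monomial order is given by its strict part \<open>lt\<close>, and the leading
  monomial and coefficient are meaningful for nonzero polynomials only.\<close>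

definition lead_mono :: "(monomial \<Rightarrow> monomial \<Rightarrow> bool) \<Rightarrow> ('k::field) pol \<Rightarrow> monomial" where
  "lead_mono lt p = (THE m. m \<in> Poly_Mapping.keys p \<and> (\<forall>n\<in>Poly_Mapping.keys p. n \<noteq> m \<longrightarrow> lt n m))"

definition lead_coeff :: "(monomial \<Rightarrow> monomial \<Rightarrow> bool) \<Rightarrow> ('k::field) pol \<Rightarrow> 'k" where
  "lead_coeff lt p = Poly_Mapping.lookup p (lead_mono lt p)"

definition initial_ideal ::
  "vertex set \<Rightarrow> (monomial \<Rightarrow> monomial \<Rightarrow> bool) \<Rightarrow> ('k::field) pol set \<Rightarrow> 'k pol set" where
  "initial_ideal V lt I = Idl\<^bsub>poly_ring V\<^esub> {monom_pol (lead_mono lt p) | p. p \<in> I \<and> p \<noteq> 0}"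

definition groebner_basis ::
  "vertex set \<Rightarrow> (monomial \<Rightarrow> monomial \<Rightarrow> bool) \<Rightarrow> ('k::field) pol set \<Rightarrow> 'k pol set \<Rightarrow> bool" where
  "groebner_basis V lt G I \<longleftrightarrow> finite G \<and> G \<subseteq> I \<and> 0 \<notin> G \<and>
     Idl\<^bsub>poly_ring V\<^esub> {monom_pol (lead_mono lt g) | g. g \<in> G} = initial_ideal V lt I"

definition mono_dvd :: "monomial \<Rightarrow> monomial \<Rightarrow> bool" where
  "mono_dvd m n \<longleftrightarrow> (\<exists>t. n = m + t)"

definition reduced_groebner_basis ::
  "vertex set \<Rightarrow> (monomial \<Rightarrow> monomial \<Rightarrow> bool) \<Rightarrow> ('k::field) pol set \<Rightarrow> 'k pol set \<Rightarrow> bool" where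
  "reduced_groebner_basis V lt G I \<longleftrightarrow> groebner_basis V lt G I \<and>
     (\<forall>g\<in>G. lead_coeff lt g = 1) \<and>
     (\<forall>g\<in>G. \<forall>h\<in>G. g \<noteq> h \<longrightarrow> (\<forall>m\<in>Poly_Mapping.keys h. \<not> mono_dvd (lead_mono lt g) m))"

text \<open>The inner 2-minors are taken up to sign: each minor has coefficients \<open>1\<close> and \<open>-1\<close>, and
  its sign is switched if necessary to make the leading coefficient \<open>1\<close>.\<close>

definition signed_inner_minors ::
  "(monomial \<Rightarrow> monomial \<Rightarrow> bool) \<Rightarrow> vertex set set \<Rightarrow> ('k::field) pol set" where
  "signed_inner_minors lt P =
     (\<lambda>f. if lead_coeff lt f = 1 then f else - f) ` inner_minors P"


section \<open>Orders\<close>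

definition vertex_less :: "nat \<Rightarrow> vertex \<Rightarrow> vertex \<Rightarrow> bool" where
  "vertex_less i a b \<longleftrightarrow>
     i = 1 \<and> (fst a < fst b \<or> fst a = fst b \<and> snd a > snd b) \<or>
     i = 2 \<and> (fst a > fst b \<or> fst a = fst b \<and> snd a > snd b) \<or>
     i = 3 \<and> (fst a > fst b \<or> fst a = fst b \<and> snd a < snd b) \<or>
     i = 4 \<and> (fst a < fst b \<or> fst a = fst b \<and> snd a < snd b) \<or>
     i = 5 \<and> (snd a < snd b \<or> snd a = snd b \<and> fst a > fst b) \<or>
     i = 6 \<and> (snd a < snd b \<or> snd a = snd b \<and> fst a < fst b) \<or>
     i = 7 \<and> (snd a > snd b \<or> snd a = snd b \<and> fst a < fst b) \<or>
     i = 8 \<and> (snd a > snd b \<or> snd a = snd b \<and> fst a > fst b)"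

text \<open>The cyclic shift of a total order that starts at \<open>v\<close>: the elements from \<open>v\<close> on come first,
  followed by those below \<open>v\<close>, i.e.\ \<open>v\<^sub>k < \<dots> < v\<^sub>n < v\<^sub>1 < \<dots> < v\<^sub>k\<^sub>-\<^sub>1\<close> for \<open>v = v\<^sub>k\<close>.\<close>

definition rotated :: "('a \<Rightarrow> 'a \<Rightarrow> bool) \<Rightarrow> 'a \<Rightarrow> 'a \<Rightarrow> 'a \<Rightarrow> bool" where
  "rotated lt v a b \<longleftrightarrow>
     (if lt a v then lt b v \<and> lt a b else lt b v \<or> lt a b)"

definition total_degree :: "monomial \<Rightarrow> nat" where
  "total_degree m = (\<Sum>v\<in>Poly_Mapping.keys m. Poly_Mapping.lookup m v)"

text \<open>Among monomials of equal degree, the smaller one is that with the larger exponent at the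
  smallest variable where the two differ.\<close>

definition grevlex :: "(vertex \<Rightarrow> vertex \<Rightarrow> bool) \<Rightarrow> monomial \<Rightarrow> monomial \<Rightarrow> bool" where
  "grevlex lt m n \<longleftrightarrow> total_degree m < total_degree n \<or>
     total_degree m = total_degree n \<and>
     (\<exists>v. Poly_Mapping.lookup m v > Poly_Mapping.lookup n v \<and>
        (\<forall>w. lt w v \<longrightarrow> Poly_Mapping.lookup m w = Poly_Mapping.lookup n w))"

definition mono_less :: "nat \<Rightarrow> monomial \<Rightarrow> monomial \<Rightarrow> bool" where
  "mono_less i = grevlex (vertex_less i)"

definition mono_less_at :: "nat \<Rightarrow> vertex \<Rightarrow> monomial \<Rightarrow> monomial \<Rightarrow> bool" where
  "mono_less_at i v = grevlex (rotated (vertex_less i) v)"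


section \<open>The conditions \<open>\<pi>\<^sub>i\<close>\<close>

datatype quadrant = LL | LR | UL | UR

primrec inner_quadrant ::
  "vertex set set \<Rightarrow> nat \<Rightarrow> nat \<Rightarrow> nat \<Rightarrow> nat \<Rightarrow> nat \<Rightarrow> nat \<Rightarrow> quadrant \<Rightarrow> bool" where
  "inner_quadrant P x0 x1 x2 y0 y1 y2 LL \<longleftrightarrow> inner_interval P (x0, y0) (x1, y1)"
| "inner_quadrant P x0 x1 x2 y0 y1 y2 LR \<longleftrightarrow> inner_interval P (x1, y0) (x2, y1)"
| "inner_quadrant P x0 x1 x2 y0 y1 y2 UL \<longleftrightarrow> inner_interval P (x0, y1) (x1, y2)"
| "inner_quadrant P x0 x1 x2 y0 y1 y2 UR \<longleftrightarrow> inner_interval P (x1, y1) (x2, y2)"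

text \<open>The coordinates may be taken to be natural numbers: any three of the four intervals being
  inner intervals forces all of them to be.\<close>

definition missing ::
  "vertex set set \<Rightarrow> nat \<Rightarrow> nat \<Rightarrow> nat \<Rightarrow> nat \<Rightarrow> nat \<Rightarrow> nat \<Rightarrow> quadrant \<Rightarrow> bool" where
  "missing P x0 x1 x2 y0 y1 y2 X \<longleftrightarrow> \<not> inner_quadrant P x0 x1 x2 y0 y1 y2 X \<and>
     (\<forall>Y. Y \<noteq> X \<longrightarrow> inner_quadrant P x0 x1 x2 y0 y1 y2 Y)"

definition pi_cond :: "nat \<Rightarrow> vertex set set \<Rightarrow> vertex \<Rightarrow> bool" where
  "pi_cond i P v \<longleftrightarrow> (\<exists>x0 x1 x2 y0 y1 y2. x0 < x1 \<and> x1 < x2 \<and> y0 < y1 \<and> y1 < y2 \<and>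
     (let miss = missing P x0 x1 x2 y0 y1 y2 in
        i = 1 \<and> (miss LR \<and> v = (x0, y1) \<or> miss LL \<and> v = (x1, y1)) \<or>
        i = 2 \<and> (miss LL \<and> v = (x2, y1) \<or> miss LR \<and> v = (x1, y1)) \<or>
        i = 3 \<and> (miss UL \<and> v = (x2, y1) \<or> miss UR \<and> v = (x1, y1)) \<or>
        i = 4 \<and> (miss UR \<and> v = (x0, y1) \<or> miss UL \<and> v = (x1, y1)) \<or>
        i = 5 \<and> (miss UL \<and> v = (x1, y0) \<or> miss LL \<and> v = (x1, y1)) \<or>
        i = 6 \<and> (miss UR \<and> v = (x1, y0) \<or> miss LR \<and> v = (x1, y1)) \<or>
        i = 7 \<and> (miss LR \<and> v = (x1, y2) \<or> miss UR \<and> v = (x1, y1)) \<or>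
        i = 8 \<and> (miss LL \<and> v = (x1, y2) \<or> miss UL \<and> v = (x1, y1))))"

end

theory Submission
  imports Defs "HOL-Library.Confluence" "HOL-Library.Nat_Bijection"
begin

text \<open>
  If two vertices \<open>p\<close>, \<open>q\<close> are opposite corners of an inner interval, a monomial divisible by \<open>x\<^sub>p
  x\<^sub>q\<close> may be \<^emph>\<open>flipped\<close>: \<open>x\<^sub>p x\<^sub>q\<close> is replaced by the product of the other two corners. The
  polyomino ideal is spanned by the differences of monomials that are related by flips, that is,
  it consists of the polynomials whose coefficients sum to zero over every flip class
  (\<open>polyomino_ideal_eq\<close>). Orient each flip downwards in a monomial order. If any two
  flip-equivalent monomials have a common descendant, then the leading monomial of a nonzero
  element \<open>f\<close> of the ideal cannot be irreducible: another monomial of \<open>f\<close> in its class would have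
  to descend to it. So the minors form a Groebner basis (\<open>joinable_imp_reduced_groebner\<close>), and
  Newman's lemma reduces everything to local confluence.

  In grevlex the trailing term of a minor is the pair that contains the smallest of the four
  corners. Each of the eight orders on vertices is lexicographic in suitable coordinates \<open>xc\<close>,
  \<open>yc\<close>, in which the leading pair of an unrotated order is always the anti-diagonal one; after
  rotation at \<open>v\<close> it is the diagonal one exactly if \<open>v\<close> lies after the lower left corner and not
  after the lower right corner. A critical peak has the form \<open>x\<^sub>u x\<^sub>p x\<^sub>q\<close> with leading pairs \<open>u,
  p\<close> and \<open>u, q\<close>. If \<open>p\<close> and \<open>q\<close> share a row or a column, a third flip joins the two results.
  Otherwise the three vertices form a permutation of a three by three grid, and the two results
  have a common flip neighbour through which they can be joined, except in a few configurations
  (\<open>peak_closes_sorted\<close>). One of these is that only two opposite quadrants of the grid, lying on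
  the leading diagonal of the unrotated order, are inner; it is excluded because the minors are a
  Groebner basis for one unrotated order (\<open>groebner_imp_bridged\<close>), and this exclusion is the same
  for all orders of one parity (\<open>bridged_transfer\<close>). In the others a quadrant is missing and \<open>v\<close>
  lies on a certain side of a cell of the grid; after moving the middle row of the grid to \<open>v\<close>
  they are instances of the condition \<open>\<pi>\<^sub>k\<close> at \<open>v\<close>.

  For primality, \<open>x\<^sub>v\<close> is the smallest variable of the order rotated at \<open>v\<close>, so it occurs in no
  leading term. Confluence for that order then shows that \<open>x\<^sub>v\<close> can be cancelled from
  flip-equivalent monomials (\<open>flips_cancel\<close>). Up to monomial factors, a flip across a single cell
  eliminates the upper right corner of that cell, which gives weights in a free abelian group such
  that two monomials of the ring are flip-equivalent iff they have the same weight
  (\<open>monomial_weight_separates\<close>). Hence the ideal is the kernel of a homomorphism from the ring to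
  a ring of Laurent polynomials, which is a domain.
\<close>

section \<open>Termination and local confluence\<close>

lemma newman:
  assumes wf: "wfP r\<inverse>\<inverse>"
    and loc: "\<And>x y z. r x y \<Longrightarrow> r x z \<Longrightarrow> \<exists>u. r\<^sup>*\<^sup>* y u \<and> r\<^sup>*\<^sup>* z u"
  shows "confluentp r"
proof (rule confluentpI)
  fix x y z
  assume "r\<^sup>*\<^sup>* x y" "r\<^sup>*\<^sup>* x z"
  with wf show "\<exists>u. r\<^sup>*\<^sup>* y u \<and> r\<^sup>*\<^sup>* z u"
  proof (induction x arbitrary: y z rule: wfp_induct_rule)
    case (less x)
    show ?case
    proof (cases "x = y \<or> x = z")
      case True
      with less.prems show ?thesis by blast
    next
      case False
      then obtain y1 z1 where y1: "r x y1" "r\<^sup>*\<^sup>* y1 y" and z1: "r x z1" "r\<^sup>*\<^sup>* z1 z"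
        using less.prems by (metis converse_rtranclpE)
      obtain u where u: "r\<^sup>*\<^sup>* y1 u" "r\<^sup>*\<^sup>* z1 u" using loc y1 z1 by blast
      obtain w where w: "r\<^sup>*\<^sup>* y w" "r\<^sup>*\<^sup>* u w" using less.IH[of y1 y u] y1 u by auto
      have "r\<^sup>*\<^sup>* z1 w" using u w by simp
      then obtain w' where "r\<^sup>*\<^sup>* z w'" "r\<^sup>*\<^sup>* w w'" using less.IH[of z1 z w] z1 by auto
      with w show ?thesis by (meson rtranclp_trans)
    qed
  qed
qed

section \<open>Monomials and the graded reverse lexicographic order\<close>

text \<open>The exponent \<open>e\<^sub>v\<close> of the variable \<open>x\<^sub>v\<close>.\<close>

abbreviation E :: "vertex \<Rightarrow> monomial" where "E v \<equiv> Poly_Mapping.single v 1"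

lemma total_degree_superset:
  assumes "finite A" "Poly_Mapping.keys m \<subseteq> A"
  shows "total_degree m = (\<Sum>v\<in>A. Poly_Mapping.lookup m v)"
  unfolding total_degree_def using assms
  by (intro sum.mono_neutral_left) (auto simp: in_keys_iff)

lemma total_degree_add: "total_degree (m + n) = total_degree m + total_degree n"
proof -
  let ?A = "Poly_Mapping.keys m \<union> Poly_Mapping.keys n"
  have "total_degree (m + n) = (\<Sum>v\<in>?A. Poly_Mapping.lookup (m + n) v)"
    using Poly_Mapping.keys_add[of m n] by (intro total_degree_superset) auto
  also have "\<dots> = total_degree m + total_degree n"
    using total_degree_superset[of ?A m] total_degree_superset[of ?A n]
    by (simp add: lookup_add sum.distrib)
  finally show ?thesis .
qed

lemma total_degree_single [simp]: "total_degree (Poly_Mapping.single v k) = k"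
  by (simp add: total_degree_def)

lemma keys_add_nat: "Poly_Mapping.keys (m + n :: monomial) = Poly_Mapping.keys m \<union> Poly_Mapping.keys n"
  by (auto simp: in_keys_iff lookup_add)

lemma finite_monomials_of_degree:
  assumes "finite A"
  shows "finite {m. Poly_Mapping.keys m \<subseteq> A \<and> total_degree m = d}" (is "finite ?S")
proof -
  have "Poly_Mapping.lookup ` ?S \<subseteq> {f. \<forall>x. (x \<in> A \<longrightarrow> f x \<in> {..d}) \<and> (x \<notin> A \<longrightarrow> f x = 0)}"
  proof -
    have "\<And>m x. Poly_Mapping.keys m \<subseteq> A \<Longrightarrow> x \<notin> A \<Longrightarrow> Poly_Mapping.lookup m x = (0::nat)"
      by (auto simp: in_keys_iff)
    moreover have "Poly_Mapping.lookup m x \<le> total_degree m"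
      if "Poly_Mapping.keys m \<subseteq> A" "x \<in> A" for m x
      using total_degree_superset[OF assms that(1)] assms that(2) by (simp add: member_le_sum)
    ultimately show ?thesis by auto
  qed
  moreover have "finite {f. \<forall>x. (x \<in> A \<longrightarrow> f x \<in> {..d}) \<and> (x \<notin> A \<longrightarrow> f x = (0::nat))}"
    using assms by (intro finite_set_of_finite_funs) auto
  ultimately have "finite (Poly_Mapping.lookup ` ?S)"
    by (rule finite_subset)
  then show ?thesis
    by (rule finite_imageD) (rule inj_onI, simp only: poly_mapping_eq_iff)
qed

lemma lead_mono_eqI:
  assumes "\<And>m n. lt m n \<Longrightarrow> \<not> lt n m"
    and "m \<in> Poly_Mapping.keys f" "\<And>n. n \<in> Poly_Mapping.keys f \<Longrightarrow> n \<noteq> m \<Longrightarrow> lt n m"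
  shows "lead_mono lt f = m"
  unfolding lead_mono_def
proof (rule the_equality)
  show "m \<in> Poly_Mapping.keys f \<and> (\<forall>n\<in>Poly_Mapping.keys f. n \<noteq> m \<longrightarrow> lt n m)"
    using assms(2,3) by simp
next
  fix m' assume m': "m' \<in> Poly_Mapping.keys f \<and> (\<forall>n\<in>Poly_Mapping.keys f. n \<noteq> m' \<longrightarrow> lt n m')"
  show "m' = m"
  proof (rule ccontr)
    assume "m' \<noteq> m"
    then have "lt m m'" "lt m' m" using m' assms(2,3) by auto
    with assms(1) show False by blast
  qed
qed

text \<open>A strict total order on the lattice, the order of the variables.\<close>

locale vertex_order =
  fixes lt :: "vertex \<Rightarrow> vertex \<Rightarrow> bool"
  assumes lt_irrefl: "\<not> lt a a"
    and lt_trans: "lt a b \<Longrightarrow> lt b c \<Longrightarrow> lt a c"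
    and lt_total: "a \<noteq> b \<Longrightarrow> lt a b \<or> lt b a"
begin

lemma lt_asym: "lt a b \<Longrightarrow> \<not> lt b a"
  using lt_irrefl lt_trans by blast

lemma finite_has_least:
  assumes "finite A" "A \<noteq> {}"
  obtains a where "a \<in> A" "\<And>b. b \<in> A \<Longrightarrow> b \<noteq> a \<Longrightarrow> lt a b"
proof -
  have "\<exists>a\<in>A. \<forall>b\<in>A. b \<noteq> a \<longrightarrow> lt a b"
    using assms
  proof (induction rule: finite_ne_induct)
    case (insert x F)
    then obtain a where "a \<in> F" "\<forall>b\<in>F. b \<noteq> a \<longrightarrow> lt a b" by blast
    with insert.hyps lt_total[of x a] show ?case by (metis insert_iff lt_trans)
  qed simp
  with that show thesis by blast
qed

lemma grevlex_irrefl: "\<not> grevlex lt m m"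
  by (simp add: grevlex_def)

lemma grevlex_trans:
  assumes "grevlex lt m n" "grevlex lt n r"
  shows "grevlex lt m r"
proof (cases "total_degree m = total_degree n \<and> total_degree n = total_degree r")
  case False
  with assms show ?thesis by (auto simp: grevlex_def)
next
  case True
  with assms obtain v w where
    v: "Poly_Mapping.lookup m v > Poly_Mapping.lookup n v"
      "\<And>u. lt u v \<Longrightarrow> Poly_Mapping.lookup m u = Poly_Mapping.lookup n u" and
    w: "Poly_Mapping.lookup n w > Poly_Mapping.lookup r w"
      "\<And>u. lt u w \<Longrightarrow> Poly_Mapping.lookup n u = Poly_Mapping.lookup r u"
    by (auto simp: grevlex_def)
  \<comment> \<open>The smaller of the two deciding variables decides.\<close>
  define z where "z = (if lt w v then w else v)"
  have "Poly_Mapping.lookup m z > Poly_Mapping.lookup r z"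
  proof (cases "lt w v")
    case True
    with v(2)[of w] w(1) show ?thesis by (simp add: z_def)
  next
    case False
    then have "v = w \<or> lt v w" using lt_total by blast
    then have "Poly_Mapping.lookup n v \<ge> Poly_Mapping.lookup r v"
      using w(1) w(2)[of v] by auto
    with v(1) False show ?thesis by (simp add: z_def)
  qed
  moreover have "Poly_Mapping.lookup m u = Poly_Mapping.lookup r u" if "lt u z" for u
  proof -
    have "lt u v" "lt u w"
      using that lt_trans[of u w v] lt_trans[of u v w] lt_total[of v w]
      by (auto simp: z_def split: if_splits)
    then show ?thesis using v(2) w(2) by simp
  qed
  ultimately show ?thesis
    using True unfolding grevlex_def by (intro disjI2 conjI exI[of _ z]) simp_all
qed

lemma grevlex_asym: "grevlex lt m n \<Longrightarrow> \<not> grevlex lt n m"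
  using grevlex_trans grevlex_irrefl by blast

lemma grevlex_total:
  assumes "m \<noteq> n"
  shows "grevlex lt m n \<or> grevlex lt n m"
proof -
  let ?A = "{v. Poly_Mapping.lookup m v \<noteq> Poly_Mapping.lookup n v}"
  have "?A \<subseteq> Poly_Mapping.keys m \<union> Poly_Mapping.keys n"
    by (auto simp: in_keys_iff)
  then have "finite ?A" by (rule finite_subset) auto
  moreover have "?A \<noteq> {}"
    using assms poly_mapping_eqI[of m n] by blast
  ultimately obtain a where "a \<in> ?A" "\<And>b. b \<in> ?A \<Longrightarrow> b \<noteq> a \<Longrightarrow> lt a b"
    by (rule finite_has_least) blast
  then have "Poly_Mapping.lookup m a \<noteq> Poly_Mapping.lookup n a"
    "\<And>w. lt w a \<Longrightarrow> Poly_Mapping.lookup m w = Poly_Mapping.lookup n w"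
    using lt_asym lt_irrefl by blast+
  then show ?thesis
    unfolding grevlex_def by (metis linorder_neq_iff)
qed

lemma grevlex_add_iff: "grevlex lt (m + t) (n + t) \<longleftrightarrow> grevlex lt m n"
  by (simp add: grevlex_def total_degree_add lookup_add)

lemma lead_mono_max:
  assumes "f \<noteq> 0"
  shows "lead_mono (grevlex lt) f \<in> Poly_Mapping.keys f"
    and "\<And>n. n \<in> Poly_Mapping.keys f \<Longrightarrow> n \<noteq> lead_mono (grevlex lt) f
      \<Longrightarrow> grevlex lt n (lead_mono (grevlex lt) f)"
proof -
  have "\<exists>m\<in>A. \<forall>n\<in>A. n \<noteq> m \<longrightarrow> grevlex lt n m" if "finite A" "A \<noteq> {}" for A
    using that
  proof (induction rule: finite_ne_induct)
    case (insert x F)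
    then obtain a where "a \<in> F" "\<forall>b\<in>F. b \<noteq> a \<longrightarrow> grevlex lt b a" by blast
    with insert.hyps grevlex_total[of x a] show ?case by (metis insert_iff grevlex_trans)
  qed simp
  from this[of "Poly_Mapping.keys f"] assms obtain m
    where m: "m \<in> Poly_Mapping.keys f" "\<And>n. n \<in> Poly_Mapping.keys f \<Longrightarrow> n \<noteq> m \<Longrightarrow> grevlex lt n m"
    by (metis finite_keys keys_eq_empty)
  then have "lead_mono (grevlex lt) f = m"
    by (intro lead_mono_eqI grevlex_asym)
  with m show "lead_mono (grevlex lt) f \<in> Poly_Mapping.keys f"
    and "\<And>n. n \<in> Poly_Mapping.keys f \<Longrightarrow> n \<noteq> lead_mono (grevlex lt) f
      \<Longrightarrow> grevlex lt n (lead_mono (grevlex lt) f)" by simp_all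
qed

text \<open>For disjoint squarefree quadratic monomials, the smaller one is that which contains the smallest
  of the four variables.\<close>

lemma grevlex_pair_iff:
  assumes "a \<noteq> b" "c \<noteq> d" "{a, b} \<inter> {c, d} = {}"
  shows "grevlex lt (E c + E d) (E a + E b) \<longleftrightarrow> (\<exists>z\<in>{c, d}. lt z a \<and> lt z b)"
proof
  assume "\<exists>z\<in>{c, d}. lt z a \<and> lt z b"
  then obtain z0 where z0: "z0 \<in> {c, d}" "lt z0 a" "lt z0 b" by blast
  obtain z where z: "z \<in> {c, d}" "lt z a" "lt z b" "\<forall>w\<in>{c, d}. w = z \<or> lt z w"
    using z0 assms(2) lt_total[of c d] lt_trans by (elim insertE; blast)
  moreover have "\<And>w. lt w z \<Longrightarrow> w \<notin> {a, b, c, d}"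
    using z by (metis empty_iff insert_iff lt_asym lt_irrefl)
  moreover have "Poly_Mapping.lookup (E c + E d) z > Poly_Mapping.lookup (E a + E b) z"
    using z(1) assms by (auto simp: lookup_add lookup_single when_def)
  ultimately show "grevlex lt (E c + E d) (E a + E b)"
    unfolding grevlex_def
    by (intro disjI2 conjI exI[of _ z] allI impI)
      (simp_all add: total_degree_add, simp add: lookup_add lookup_single when_def, metis)
next
  assume "grevlex lt (E c + E d) (E a + E b)"
  then obtain z where z: "Poly_Mapping.lookup (E c + E d) z > Poly_Mapping.lookup (E a + E b) z"
    "\<And>w. lt w z \<Longrightarrow> Poly_Mapping.lookup (E c + E d) w = Poly_Mapping.lookup (E a + E b) w"
    by (auto simp: grevlex_def total_degree_add)
  have "z \<in> {c, d}"
    using z(1) by (auto simp: lookup_add lookup_single when_def split: if_splits)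
  moreover have "\<not> lt a z" "\<not> lt b z"
    using z(2)[of a] z(2)[of b] assms by (auto simp: lookup_add lookup_single when_def split: if_splits)
  ultimately show "\<exists>z\<in>{c, d}. lt z a \<and> lt z b"
    using lt_total[of z a] lt_total[of z b] assms by blast
qed

end

section \<open>Peaks on a grid of three rows and three columns\<close>

text \<open>The point \<open>(x, y)\<close> precedes \<open>v\<close> in the lexicographic order.\<close>

definition below :: "int \<times> int \<Rightarrow> int \<Rightarrow> int \<Rightarrow> bool" where
  "below v x y \<longleftrightarrow> x < fst v \<or> x = fst v \<and> y < snd v"

text \<open>For opposite corners \<open>(x, y)\<close> and \<open>(x', y')\<close> of a rectangle: they form the leading pair for the
  lexicographic order rotated at \<open>v\<close>. The corners in increasing order are lower left, upper left,
  lower right, upper right; the smallest corner after the rotation is the first one that does not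
  precede \<open>v\<close>, or the lower left one if all precede \<open>v\<close>. So it is off the diagonal, and the
  diagonal pair leads, iff the lower left corner precedes \<open>v\<close> and the lower right one does not.\<close>

definition leads :: "int \<times> int \<Rightarrow> int \<Rightarrow> int \<Rightarrow> int \<Rightarrow> int \<Rightarrow> bool" where
  "leads v x y x' y' \<longleftrightarrow>
     ((below v (min x x') (min y y') \<and> \<not> below v (max x x') (min y y')) \<longleftrightarrow> (x < x' \<longleftrightarrow> y < y'))"

text \<open>The data of the combinatorial argument, in coordinates with a lexicographic order. \<open>R x0 x1 y0
  y1\<close> stands for the statement that all cells of the rectangle \<open>[x0, x1] \<times> [y0, y1]\<close> belong to the
  polyomino, \<open>SX\<close> and \<open>SY\<close> are the coordinates of lattice points, and \<open>v\<close> is the vertex at which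
  the order is rotated. The assumption \<open>star\<close> comes from the Groebner basis for an unrotated
  order, and \<open>pi1\<close>, \<open>pi2\<close> say that the two parts of the condition \<open>\<pi>\<close>, in the form that belongs to
  these coordinates, fail at \<open>v\<close>.\<close>

locale grid =
  fixes R :: "int \<Rightarrow> int \<Rightarrow> int \<Rightarrow> int \<Rightarrow> bool" and SX SY :: "int set" and v :: "int \<times> int"
  assumes glueX: "a < b \<Longrightarrow> b < c \<Longrightarrow> R a c y y' \<longleftrightarrow> R a b y y' \<and> R b c y y'"
    and glueY: "a < b \<Longrightarrow> b < c \<Longrightarrow> R x x' a c \<longleftrightarrow> R x x' a b \<and> R x x' b c"
    and v_in: "snd v \<in> SY"
    and star: "x0 < x1 \<Longrightarrow> x1 < x2 \<Longrightarrow> y0 < y1 \<Longrightarrow> y1 < y2 \<Longrightarrow> {x0, x1, x2} \<subseteq> SX \<Longrightarrow> {y0, y1, y2} \<subseteq> SY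
       \<Longrightarrow> R x0 x1 y1 y2 \<Longrightarrow> R x1 x2 y0 y1 \<Longrightarrow> R x0 x1 y0 y1 \<or> R x1 x2 y1 y2"
    and pi1: "x0 < x1 \<Longrightarrow> x1 < x2 \<Longrightarrow> y0 < y1 \<Longrightarrow> y1 < y2 \<Longrightarrow> {x0, x1, x2} \<subseteq> SX \<Longrightarrow> {y0, y1, y2} \<subseteq> SY
       \<Longrightarrow> v = (x0, y1) \<Longrightarrow> R x0 x1 y0 y1 \<Longrightarrow> R x1 x2 y0 y1 \<Longrightarrow> R x0 x1 y1 y2 \<Longrightarrow> R x1 x2 y1 y2"
    and pi2: "x0 < x1 \<Longrightarrow> x1 < x2 \<Longrightarrow> y0 < y1 \<Longrightarrow> y1 < y2 \<Longrightarrow> {x0, x1, x2} \<subseteq> SX \<Longrightarrow> {y0, y1, y2} \<subseteq> SY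
       \<Longrightarrow> v = (x1, y1) \<Longrightarrow> R x0 x1 y0 y1 \<Longrightarrow> R x1 x2 y0 y1 \<Longrightarrow> R x1 x2 y1 y2 \<Longrightarrow> R x0 x1 y1 y2"
begin

text \<open>The rectangle with opposite corners \<open>(x, y)\<close> and \<open>(x', y')\<close>, in any position, satisfies \<open>R\<close>.\<close>

definition RB :: "int \<Rightarrow> int \<Rightarrow> int \<Rightarrow> int \<Rightarrow> bool" where
  "RB x y x' y' \<longleftrightarrow> R (min x x') (max x x') (min y y') (max y y')"

text \<open>Replacing the middle row \<open>y1\<close> of a grid by a lower row \<open>y\<close> shrinks the lower rectangles and
  enlarges the upper ones.\<close>

lemma window_y:
  assumes "y0 < y" "y \<le> y1" "y1 < y2"
  shows "R x x' y0 y1 \<Longrightarrow> R x x' y0 y"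
    and "R x x' y y2 \<Longrightarrow> R x x' y1 y2"
    and "R x x' y0 y1 \<Longrightarrow> R x x' y1 y2 \<Longrightarrow> R x x' y y2"
  by (metis assms glueY[of y0 y y1 x x'] glueY[of y y1 y2 x x'] order_le_less)+

text \<open>When the upper right (upper left) quadrant is the missing one, \<open>v\<close> is neither the middle point of
  the left (middle) column nor a point of this column strictly between the lowest and the middle
  one: the middle row can be moved down to the height of \<open>v\<close>. Then the lower quadrants shrink, and
  the upper quadrants grow by parts of the lower ones, so that the inner ones stay inner and the
  missing one stays missing.\<close>

lemma no_critical_cut:
  assumes o: "x0 < x1" "x1 < x2" "y0 < y1" "y1 < y2" and S: "{x0, x1, x2} \<subseteq> SX" "{y0, y1, y2} \<subseteq> SY"
  shows "R x0 x1 y1 y2 \<Longrightarrow> R x1 x2 y0 y1 \<Longrightarrow> R x0 x1 y0 y1 \<or> R x1 x2 y1 y2"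
    and "R x0 x1 y0 y1 \<Longrightarrow> R x1 x2 y0 y1 \<Longrightarrow> R x0 x1 y1 y2 \<Longrightarrow> below v x0 y0 \<Longrightarrow> \<not> below v x0 y1
      \<Longrightarrow> R x1 x2 y1 y2"
    and "R x0 x1 y0 y1 \<Longrightarrow> R x1 x2 y0 y1 \<Longrightarrow> R x1 x2 y1 y2 \<Longrightarrow> below v x1 y0 \<Longrightarrow> \<not> below v x1 y1
      \<Longrightarrow> R x0 x1 y1 y2"
proof -
  show "R x0 x1 y1 y2 \<Longrightarrow> R x1 x2 y0 y1 \<Longrightarrow> R x0 x1 y0 y1 \<or> R x1 x2 y1 y2"
    using star[OF o S] by blast
next
  assume R: "R x0 x1 y0 y1" "R x1 x2 y0 y1" "R x0 x1 y1 y2" and b: "below v x0 y0" "\<not> below v x0 y1"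
  obtain y where y: "v = (x0, y)" "y0 < y" "y \<le> y1"
  proof
    have "fst v = x0"
      using b unfolding below_def by linarith
    then show "v = (x0, snd v)"
      by (intro prod_eqI) simp_all
    show "y0 < snd v" "snd v \<le> y1"
      using b unfolding below_def by linarith+
  qed
  have "R x0 x1 y0 y" "R x1 x2 y0 y" "R x0 x1 y y2"
    using window_y[OF y(2,3) o(4)] R by blast+
  moreover have "y < y2" "{y0, y, y2} \<subseteq> SY"
    using y o S(2) v_in by auto
  ultimately have "R x1 x2 y y2"
    using pi1[OF o(1,2) y(2) _ S(1) _ y(1)] by blast
  then show "R x1 x2 y1 y2"
    using window_y[OF y(2,3) o(4)] by blast
next
  assume R: "R x0 x1 y0 y1" "R x1 x2 y0 y1" "R x1 x2 y1 y2" and b: "below v x1 y0" "\<not> below v x1 y1"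
  obtain y where y: "v = (x1, y)" "y0 < y" "y \<le> y1"
  proof
    have "fst v = x1"
      using b unfolding below_def by linarith
    then show "v = (x1, snd v)"
      by (intro prod_eqI) simp_all
    show "y0 < snd v" "snd v \<le> y1"
      using b unfolding below_def by linarith+
  qed
  have "R x0 x1 y0 y" "R x1 x2 y0 y" "R x1 x2 y y2"
    using window_y[OF y(2,3) o(4)] R by blast+
  moreover have "y < y2" "{y0, y, y2} \<subseteq> SY"
    using y o S(2) v_in by auto
  ultimately have "R x0 x1 y y2"
    using pi2[OF o(1,2) y(2) _ S(1) _ y(1)] by blast
  then show "R x0 x1 y1 y2"
    using window_y[OF y(2,3) o(4)] by blast
qed

text \<open>The points that precede \<open>v\<close> form an initial segment of the grid.\<close>

lemma below_chain:
  assumes "x0 < x1" "x1 < x2" "y0 < y1" "y1 < y2"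
  shows "below v x2 y1 \<Longrightarrow> below v x2 y0" "below v x2 y0 \<Longrightarrow> below v x1 y1"
    "below v x1 y1 \<Longrightarrow> below v x1 y0" "below v x1 y0 \<Longrightarrow> below v x0 y1" "below v x0 y1 \<Longrightarrow> below v x0 y0"
  using assms by (auto simp: below_def)

text \<open>The two results of the peak \<open>x\<^sub>u x\<^sub>p x\<^sub>q\<close>, in which \<open>u\<close> is flipped with \<open>p\<close> or with \<open>q\<close>, are
  permutations of the same parity of a three by three grid. Two further permutations of the other
  parity are neighbours of both. The condition says that for one of these the two flips are
  available and do not both point away from it.\<close>

definition closes :: "int \<Rightarrow> int \<Rightarrow> int \<Rightarrow> int \<Rightarrow> int \<Rightarrow> int \<Rightarrow> bool" where
  "closes ux uy px py qx qy \<longleftrightarrow>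
     RB px uy qx qy \<and> RB ux qy px py \<and> \<not> (leads v px qy qx uy \<and> leads v ux py px qy) \<or>
     RB ux py qx qy \<and> RB px py qx uy \<and> \<not> (leads v ux qy qx py \<and> leads v px uy qx py)"

text \<open>The heart of the confluence proof. Everything is a propositional statement about the four
  quadrants and the positions of six grid points relative to \<open>v\<close>: leading pairs of a rectangle
  depend only on its lower side.\<close>

lemma peak_closes_sorted:
  assumes o: "x0 < x1" "x1 < x2" "y0 < y1" "y1 < y2" and S: "{x0, x1, x2} \<subseteq> SX" "{y0, y1, y2} \<subseteq> SY"
    and p: "(ux, px, qx) \<in> {(x0,x1,x2),(x0,x2,x1),(x1,x0,x2),(x1,x2,x0),(x2,x0,x1),(x2,x1,x0)}"
    and q: "(uy, py, qy) \<in> {(y0,y1,y2),(y0,y2,y1),(y1,y0,y2),(y1,y2,y0),(y2,y0,y1),(y2,y1,y0)}"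
    and "RB ux uy px py" "RB ux uy qx qy" "leads v ux uy px py" "leads v ux uy qx qy"
  shows "closes ux uy px py qx qy"
proof -
  have mm: "min x0 x1 = x0" "min x1 x0 = x0" "min x0 x2 = x0" "min x2 x0 = x0" "min x1 x2 = x1"
    "min x2 x1 = x1"
    "max x0 x1 = x1" "max x1 x0 = x1" "max x0 x2 = x2" "max x2 x0 = x2" "max x1 x2 = x2" "max x2 x1 = x2"
    "min y0 y1 = y0" "min y1 y0 = y0" "min y0 y2 = y0" "min y2 y0 = y0" "min y1 y2 = y1" "min y2 y1 = y1"
    "max y0 y1 = y1" "max y1 y0 = y1" "max y0 y2 = y2" "max y2 y0 = y2" "max y1 y2 = y2" "max y2 y1 = y2"
    "x0 < x1 \<longleftrightarrow> True" "x1 < x0 \<longleftrightarrow> False" "x0 < x2 \<longleftrightarrow> True" "x2 < x0 \<longleftrightarrow> False" "x1 < x2 \<longleftrightarrow> True" "x2 < x1 \<longleftrightarrow> False"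
    "y0 < y1 \<longleftrightarrow> True" "y1 < y0 \<longleftrightarrow> False" "y0 < y2 \<longleftrightarrow> True" "y2 < y0 \<longleftrightarrow> False" "y1 < y2 \<longleftrightarrow> True" "y2 < y1 \<longleftrightarrow> False"
    using o by auto
  have gl: "\<And>y y'. R x0 x2 y y' \<longleftrightarrow> R x0 x1 y y' \<and> R x1 x2 y y'"
    "\<And>x x'. R x x' y0 y2 \<longleftrightarrow> R x x' y0 y1 \<and> R x x' y1 y2"
    using glueX[OF o(1,2)] glueY[OF o(3,4)] by blast+
  have sc: "R x0 x1 y1 y2 \<and> R x1 x2 y0 y1 \<longrightarrow> R x0 x1 y0 y1 \<or> R x1 x2 y1 y2"
    "R x0 x1 y0 y1 \<and> R x1 x2 y0 y1 \<and> R x0 x1 y1 y2 \<and> below v x0 y0 \<and> \<not> below v x0 y1 \<longrightarrow> R x1 x2 y1 y2"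
    "R x0 x1 y0 y1 \<and> R x1 x2 y0 y1 \<and> R x1 x2 y1 y2 \<and> below v x1 y0 \<and> \<not> below v x1 y1 \<longrightarrow> R x0 x1 y1 y2"
    "below v x2 y1 \<longrightarrow> below v x2 y0" "below v x2 y0 \<longrightarrow> below v x1 y1"
    "below v x1 y1 \<longrightarrow> below v x1 y0" "below v x1 y0 \<longrightarrow> below v x0 y1" "below v x0 y1 \<longrightarrow> below v x0 y0"
    using no_critical_cut[OF o S] below_chain[OF o] by blast+
  \<comment> \<open>Each of the 36 assignments leaves a propositional tautology about \<open>R\<close> on the quadrants and
    \<open>below\<close> on the grid points.\<close>
  show ?thesis
    using p q assms(9-) sc
    apply -
    apply (unfold insert_iff empty_iff prod.inject)
    apply (elim disjE conjE FalseE)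
    apply (hypsubst_thin, unfold closes_def RB_def leads_def mm gl, sat)+
    done
qed

lemma sorted_three:
  fixes a b c :: int
  assumes "a \<noteq> b" "a \<noteq> c" "b \<noteq> c"
  obtains z0 z1 z2 where "z0 < z1" "z1 < z2" "{z0, z1, z2} = {a, b, c}"
    "(a, b, c) \<in> {(z0,z1,z2),(z0,z2,z1),(z1,z0,z2),(z1,z2,z0),(z2,z0,z1),(z2,z1,z0)}"
proof -
  consider "a < b" "b < c" | "a < c" "c < b" | "b < a" "a < c" | "b < c" "c < a" | "c < a"
    "a < b" | "c < b" "b < a"
    using assms by linarith
  then show thesis
  proof cases
    case 1 then show ?thesis by (intro that[of a b c]) auto
  next
    case 2 then show ?thesis by (intro that[of a c b]) auto
  next
    case 3 then show ?thesis by (intro that[of b a c]) auto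
  next
    case 4 then show ?thesis by (intro that[of b c a]) auto
  next
    case 5 then show ?thesis by (intro that[of c a b]) auto
  next
    case 6 then show ?thesis by (intro that[of c b a]) auto
  qed
qed

lemma peak_closes:
  assumes "ux \<noteq> px" "ux \<noteq> qx" "px \<noteq> qx" "uy \<noteq> py" "uy \<noteq> qy" "py \<noteq> qy"
    and S: "{ux, px, qx} \<subseteq> SX" "{uy, py, qy} \<subseteq> SY"
    and peak: "RB ux uy px py" "RB ux uy qx qy" "leads v ux uy px py" "leads v ux uy qx qy"
  shows "closes ux uy px py qx qy"
proof -
  obtain x0 x1 x2 where x: "x0 < x1" "x1 < x2" "{x0, x1, x2} = {ux, px, qx}"
    "(ux, px, qx) \<in> {(x0,x1,x2),(x0,x2,x1),(x1,x0,x2),(x1,x2,x0),(x2,x0,x1),(x2,x1,x0)}"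
    using assms(1-3) by (rule sorted_three)
  obtain y0 y1 y2 where y: "y0 < y1" "y1 < y2" "{y0, y1, y2} = {uy, py, qy}"
    "(uy, py, qy) \<in> {(y0,y1,y2),(y0,y2,y1),(y1,y0,y2),(y1,y2,y0),(y2,y0,y1),(y2,y1,y0)}"
    using assms(4-6) by (rule sorted_three)
  from S show ?thesis
    unfolding x(3)[symmetric] y(3)[symmetric]
    by (rule peak_closes_sorted[OF x(1,2) y(1,2) _ _ x(4) y(4) peak])
qed

text \<open>If two rectangles over the same columns share the row \<open>y\<close>, then the rectangle between their
  other rows is covered by them.\<close>

lemma RB_third_row:
  assumes "RB x y x' a" "RB x y x' b" "a \<noteq> y" "b \<noteq> y" "a \<noteq> b"
  shows "RB x a x' b"
proof -
  consider "a < b" "b < y" | "a < y" "y < b" | "b < a" "a < y" | "b < y" "y < a" | "y < a"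
    "a < b" | "y < b" "b < a"
    using assms by linarith
  then show ?thesis
    using assms(1,2) by cases (simp_all add: RB_def min_def max_def glueY)
qed

lemma RB_third_column:
  assumes "RB x y a y'" "RB x y b y'" "a \<noteq> x" "b \<noteq> x" "a \<noteq> b"
  shows "RB a y b y'"
proof -
  consider "a < b" "b < x" | "a < x" "x < b" | "b < a" "a < x" | "b < x" "x < a" | "x < a"
    "a < b" | "x < b" "b < a"
    using assms by linarith
  then show ?thesis
    using assms(1,2) by cases (simp_all add: RB_def min_def max_def glueX)
qed

end

section \<open>Coordinates in which the vertex orders are lexicographic\<close>

text \<open>Coordinates in which the order \<open><\<^sup>k\<close> is lexicographic: \<open>xc\<close> is compared first, \<open>yc\<close> second. Each
  is one of the two lattice coordinates up to sign.\<close>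

definition xc :: "nat \<Rightarrow> vertex \<Rightarrow> int" where
  "xc k v = (if k \<le> 4 then if k = 1 \<or> k = 4 then int (fst v) else - int (fst v)
     else if k = 5 \<or> k = 6 then int (snd v) else - int (snd v))"

definition yc :: "nat \<Rightarrow> vertex \<Rightarrow> int" where
  "yc k v = (if k \<le> 4 then if k = 3 \<or> k = 4 then int (snd v) else - int (snd v)
     else if k = 6 \<or> k = 7 then int (fst v) else - int (fst v))"

text \<open>The vertex with the coordinate \<open>xc\<close> of \<open>p\<close> and the coordinate \<open>yc\<close> of \<open>q\<close>.\<close>

definition corner :: "nat \<Rightarrow> vertex \<Rightarrow> vertex \<Rightarrow> vertex" where
  "corner k p q = (if k \<le> 4 then (fst p, snd q) else (fst q, snd p))"

lemma xc_corner [simp]: "xc k (corner k p q) = xc k p"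
  and yc_corner [simp]: "yc k (corner k p q) = yc k q"
  by (simp_all add: xc_def yc_def corner_def)

lemma vertex_eq_iff: "p = q \<longleftrightarrow> xc k p = xc k q \<and> yc k p = yc k q"
  by (auto simp: xc_def yc_def prod_eq_iff split: if_splits)

lemma corner_simps [simp]: "corner k (corner k a b) c = corner k a c"
  "corner k a (corner k b c) = corner k a c" "corner k a a = a"
  by (simp_all add: vertex_eq_iff[of _ _ k])

lemma vertex_less_iff:
  assumes "k \<in> {1..8}"
  shows "vertex_less k a b \<longleftrightarrow> xc k a < xc k b \<or> xc k a = xc k b \<and> yc k a < yc k b"
proof -
  have "k \<in> {1,2,3,4,5,6,7,8}" using assms by auto
  then show ?thesis
    by (elim insertE emptyE; auto simp: vertex_less_def xc_def yc_def)
qed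

lemma vertex_order_vertex_less: "k \<in> {1..8} \<Longrightarrow> vertex_order (vertex_less k)"
  using vertex_eq_iff[of _ _ k] by unfold_locales (auto simp: vertex_less_iff)

lemma vertex_order_rotated:
  assumes "vertex_order lt"
  shows "vertex_order (rotated lt v)"
proof -
  interpret vertex_order lt by fact
  show ?thesis
    using lt_irrefl lt_trans lt_total by unfold_locales (unfold rotated_def, metis+)
qed

text \<open>The smallest of four corners of a rectangle, for the order rotated at \<open>v\<close>, lies off the pair
  \<open>p\<close>, \<open>q\<close>.\<close>

lemma rotated_least_iff:
  assumes k: "k \<in> {1..8}" and ne: "xc k p \<noteq> xc k q" "yc k p \<noteq> yc k q"
  shows "(\<exists>z\<in>{corner k p q, corner k q p}. rotated (vertex_less k) v z p \<and> rotated (vertex_less k) v z q) \<longleftrightarrow>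
    leads (xc k v, yc k v) (xc k p) (yc k p) (xc k q) (yc k q)"
proof -
  consider "xc k p < xc k q" "yc k p < yc k q" | "xc k p < xc k q" "yc k q < yc k p"
    | "xc k q < xc k p" "yc k p < yc k q" | "xc k q < xc k p" "yc k q < yc k p"
    using ne by linarith
  then show ?thesis
    by cases (simp_all add: rotated_def vertex_less_iff[OF k] leads_def below_def min_def max_def; linarith)+
qed

section \<open>Inner intervals in these coordinates\<close>

lemma cell_subset_interval: "cell (i, j) \<subseteq> interval a b \<longleftrightarrow> fst a \<le> i \<and> i < fst b \<and> snd a \<le> j \<and> j < snd b"
  by (auto simp: cell_eq_corners interval_def)

lemma inner_interval_iff:
  "inner_interval P a b \<longleftrightarrow> fst a < fst b \<and> snd a < snd b \<and>
     (\<forall>i j. fst a \<le> i \<and> i < fst b \<and> snd a \<le> j \<and> j < snd b \<longrightarrow> cell (i, j) \<in> P)"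
proof -
  have "(\<forall>C. (\<exists>c. C = cell c) \<and> C \<subseteq> interval a b \<longrightarrow> C \<in> P) \<longleftrightarrow>
      (\<forall>i j. cell (i, j) \<subseteq> interval a b \<longrightarrow> cell (i, j) \<in> P)"
    by (metis surj_pair)
  then show ?thesis
    unfolding inner_interval_def proper_def is_cell_def by (simp add: cell_subset_interval)
qed

text \<open>The interval with opposite corners \<open>p\<close> and \<open>q\<close>, diagonal or anti-diagonal, is an inner interval.\<close>

definition box :: "vertex set set \<Rightarrow> vertex \<Rightarrow> vertex \<Rightarrow> bool" where
  "box P p q \<longleftrightarrow> inner_interval P (min (fst p) (fst q), min (snd p) (snd q))
     (max (fst p) (fst q), max (snd p) (snd q))"

text \<open>All cells with centre in the given open rectangle belong to the collection. The sum of the lower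
  left and the upper right corner of a cell is twice its centre; it has odd coordinates, so
  centres never lie on the boundary lines. In contrast to \<open>inner_interval\<close>, degenerate rectangles
  and rectangles that leave the lattice are allowed, so that the gluing rules hold for all
  integers.\<close>

definition region :: "vertex set set \<Rightarrow> nat \<Rightarrow> int \<Rightarrow> int \<Rightarrow> int \<Rightarrow> int \<Rightarrow> bool" where
  "region P k x0 x1 y0 y1 \<longleftrightarrow> (\<forall>i j.
     2 * x0 < xc k (i, j) + xc k (i + 1, j + 1) \<and> xc k (i, j) + xc k (i + 1, j + 1) < 2 * x1 \<and>
     2 * y0 < yc k (i, j) + yc k (i + 1, j + 1) \<and> yc k (i, j) + yc k (i + 1, j + 1) < 2 * y1
     \<longrightarrow> cell (i, j) \<in> P)"

lemma center_odd: "odd (xc k (i, j) + xc k (i + 1, j + 1))" "odd (yc k (i, j) + yc k (i + 1, j + 1))"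
  by (simp_all add: xc_def yc_def)

lemma region_glue:
  assumes "a < b" "b < c"
  shows "region P k a c y y' \<longleftrightarrow> region P k a b y y' \<and> region P k b c y y'"
    and "region P k x x' a c \<longleftrightarrow> region P k x x' a b \<and> region P k x x' b c"
proof -
  have "xc k (i, j) + xc k (i + 1, j + 1) \<noteq> 2 * b" "yc k (i, j) + yc k (i + 1, j + 1) \<noteq> 2 * b" for i j
    using center_odd[of k i j] by (metis dvd_triv_left)+
  then have "xc k (i, j) + xc k (i + 1, j + 1) < 2 * b \<or> 2 * b < xc k (i, j) + xc k (i + 1, j + 1)"
    "yc k (i, j) + yc k (i + 1, j + 1) < 2 * b \<or> 2 * b < yc k (i, j) + yc k (i + 1, j + 1)" for i j
    by (meson linorder_neqE)+
  with assms show "region P k a c y y' \<longleftrightarrow> region P k a b y y' \<and> region P k b c y y'"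
    and "region P k x x' a c \<longleftrightarrow> region P k x x' a b \<and> region P k x x' b c"
    unfolding region_def by (smt (verit))+
qed

lemma box_iff_region:
  "box P p q \<longleftrightarrow> xc k p \<noteq> xc k q \<and> yc k p \<noteq> yc k q \<and>
     region P k (min (xc k p) (xc k q)) (max (xc k p) (xc k q)) (min (yc k p) (yc k q)) (max (yc k p) (yc k q))"
proof -
  have *: "(2 * min (int a) (int b) < int i + int (i + 1) \<and> int i + int (i + 1) < 2 * max (int a) (int b)) =
      (min a b \<le> i \<and> i < max a b)"
    "(2 * min (- int a) (- int b) < - int i + - int (i + 1)
      \<and> - int i + - int (i + 1) < 2 * max (- int a) (- int b)) =
      (min a b \<le> i \<and> i < max a b)" for a b i
    by (auto simp: min_def max_def)
  have c: "(2 * min (xc k p) (xc k q) < xc k (i, j) + xc k (i + 1, j + 1) \<and>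
       xc k (i, j) + xc k (i + 1, j + 1) < 2 * max (xc k p) (xc k q)) \<longleftrightarrow>
       (if k \<le> 4 then min (fst p) (fst q) \<le> i \<and> i < max (fst p) (fst q)
        else min (snd p) (snd q) \<le> j \<and> j < max (snd p) (snd q))"
    for i j
    by (cases "k \<le> 4"; cases "k = 1 \<or> k = 4"; cases "k = 5 \<or> k = 6")
      (simp_all only: xc_def if_True if_False fst_conv snd_conv * simp_thms)
  have d: "(2 * min (yc k p) (yc k q) < yc k (i, j) + yc k (i + 1, j + 1) \<and>
       yc k (i, j) + yc k (i + 1, j + 1) < 2 * max (yc k p) (yc k q)) \<longleftrightarrow>
       (if k \<le> 4 then min (snd p) (snd q) \<le> j \<and> j < max (snd p) (snd q)
        else min (fst p) (fst q) \<le> i \<and> i < max (fst p) (fst q))" for i j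
    by (cases "k \<le> 4"; cases "k = 3 \<or> k = 4"; cases "k = 6 \<or> k = 7")
      (simp_all only: yc_def if_True if_False fst_conv snd_conv * simp_thms)
  have "(2 * min (xc k p) (xc k q) < xc k (i, j) + xc k (i + 1, j + 1) \<and>
       xc k (i, j) + xc k (i + 1, j + 1) < 2 * max (xc k p) (xc k q) \<and>
       2 * min (yc k p) (yc k q) < yc k (i, j) + yc k (i + 1, j + 1) \<and>
       yc k (i, j) + yc k (i + 1, j + 1) < 2 * max (yc k p) (yc k q)) \<longleftrightarrow>
     min (fst p) (fst q) \<le> i \<and> i < max (fst p) (fst q) \<and> min (snd p) (snd q) \<le> j
       \<and> j < max (snd p) (snd q)" for i j
    by (cases "k \<le> 4") (use c[of i j] d[of i j] in auto)
  moreover have "xc k p \<noteq> xc k q \<and> yc k p \<noteq> yc k q \<longleftrightarrow> fst p \<noteq> fst q \<and> snd p \<noteq> snd q"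
    by (auto simp: xc_def yc_def)
  ultimately show ?thesis
    unfolding box_def inner_interval_iff region_def fst_conv snd_conv
    by (simp only:) (auto simp: min_def max_def)
qed

section \<open>Flips of monomials\<close>

text \<open>The monomial of the other two corners of the rectangle with opposite corners \<open>p\<close> and \<open>q\<close>.\<close>

definition opp :: "vertex \<Rightarrow> vertex \<Rightarrow> monomial" where
  "opp p q = E (fst p, snd q) + E (fst q, snd p)"

text \<open>One term of an inner minor that divides \<open>m\<close> is replaced by the other term.\<close>

definition flip :: "vertex set set \<Rightarrow> monomial \<Rightarrow> monomial \<Rightarrow> bool" where
  "flip P m n \<longleftrightarrow> (\<exists>p q t. box P p q \<and> m = E p + E q + t \<and> n = opp p q + t)"

text \<open>A flip that decreases the monomial, that is, a reduction by an inner minor.\<close>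

definition step :: "vertex set set \<Rightarrow> (vertex \<Rightarrow> vertex \<Rightarrow> bool) \<Rightarrow> monomial \<Rightarrow> monomial \<Rightarrow> bool" where
  "step P lt m n \<longleftrightarrow> flip P m n \<and> grevlex lt n m"

text \<open>The vertices \<open>p\<close> and \<open>q\<close> are the variables of the leading term of an inner minor.\<close>

definition lead_pair :: "vertex set set \<Rightarrow> (vertex \<Rightarrow> vertex \<Rightarrow> bool) \<Rightarrow> vertex \<Rightarrow> vertex \<Rightarrow> bool" where
  "lead_pair P lt p q \<longleftrightarrow> box P p q \<and> grevlex lt (opp p q) (E p + E q)"

lemma opp_corner: "opp p q = E (corner k p q) + E (corner k q p)"
  by (simp add: opp_def corner_def add.commute)

lemma opp_commute: "opp p q = opp q p"
  by (simp add: opp_def add.commute)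

lemma box_commute: "box P p q = box P q p"
  by (simp add: box_def min.commute max.commute)

lemma box_distinct: "box P p q \<Longrightarrow> fst p \<noteq> fst q \<and> snd p \<noteq> snd q"
  by (auto simp: box_def inner_interval_iff)

lemma box_corners: "box P (fst p, snd q) (fst q, snd p) = box P p q"
  by (simp add: box_def min.commute max.commute)

lemma opp_corners: "opp (fst p, snd q) (fst q, snd p) = E p + E q"
  by (simp add: opp_def)

lemma flip_sym:
  assumes "flip P m n"
  shows "flip P n m"
proof -
  obtain p q t where "box P p q" "m = E p + E q + t" "n = opp p q + t"
    using assms by (auto simp: flip_def)
  then have "box P (fst p, snd q) (fst q, snd p)" "n = E (fst p, snd q) + E (fst q, snd p) + t"
    "m = opp (fst p, snd q) (fst q, snd p) + t"
    by (simp_all only: box_corners opp_corners) (simp add: opp_def)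
  then show ?thesis
    unfolding flip_def by blast
qed

lemma flip_add:
  assumes "flip P m n"
  shows "flip P (m + w) (n + w)"
proof -
  obtain p q t where "box P p q" "m = E p + E q + t" "n = opp p q + t"
    using assms by (auto simp: flip_def)
  then show ?thesis
    unfolding flip_def by (intro exI[of _ p] exI[of _ q] exI[of _ "t + w"]) (simp add: add.assoc)
qed

lemma flip_degree: "flip P m n \<Longrightarrow> total_degree n = total_degree m"
  by (auto simp: flip_def opp_def total_degree_add)

lemma box_vertices:
  assumes "box P p q"
  shows "p \<in> vertices P" "q \<in> vertices P" "(fst p, snd q) \<in> vertices P"  "(fst q, snd p) \<in> vertices P"
proof -
  have *: "p \<in> vertices P" if "box P p q" for p q
  proof -
    from that have "fst p \<noteq> fst q" "snd p \<noteq> snd q"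
      and c: "\<And>i j. min (fst p) (fst q) \<le> i \<and> i < max (fst p) (fst q) \<and>
        min (snd p) (snd q) \<le> j \<and> j < max (snd p) (snd q) \<Longrightarrow> cell (i, j) \<in> P"
      by (auto simp: box_def inner_interval_iff)
    \<comment> \<open>The cell of the rectangle at the corner \<open>p\<close>.\<close>
    define i where "i = (if fst p < fst q then fst p else fst p - 1)"
    define j where "j = (if snd p < snd q then snd p else snd p - 1)"
    have "cell (i, j) \<in> P"
      using \<open>fst p \<noteq> fst q\<close> \<open>snd p \<noteq> snd q\<close> by (intro c) (auto simp: i_def j_def min_def max_def)
    moreover have "p \<in> cell (i, j)"
      using \<open>fst p \<noteq> fst q\<close> \<open>snd p \<noteq> snd q\<close>
      by (cases p) (auto simp: cell_eq_corners i_def j_def)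
    ultimately show ?thesis by (auto simp: vertices_def)
  qed
  show "p \<in> vertices P" "q \<in> vertices P" "(fst p, snd q) \<in> vertices P"  "(fst q, snd p) \<in> vertices P"
    using * assms box_commute box_corners by metis+
qed

lemma flip_keys:
  assumes "flip P m n"
  shows "Poly_Mapping.keys n \<subseteq> vertices P \<union> Poly_Mapping.keys m"
proof -
  obtain p q t where b: "box P p q" and "m = E p + E q + t" "n = opp p q + t"
    using assms by (auto simp: flip_def)
  then show ?thesis
    using box_vertices(3,4)[OF b] by (auto simp: opp_def keys_add_nat)
qed

lemma finite_vertices: "polyomino P \<Longrightarrow> finite (vertices P)"
  unfolding polyomino_def vertices_def is_cell_def cell_def interval_def
  by (intro finite_Union) (blast, force)

context vertex_order
begin

lemma step_add: "step P lt m n \<Longrightarrow> step P lt (m + w) (n + w)"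
  by (simp add: step_def flip_add grevlex_add_iff)

lemma steps_add: "(step P lt)\<^sup>*\<^sup>* m n \<Longrightarrow> (step P lt)\<^sup>*\<^sup>* (m + w) (n + w)"
  by (induction rule: rtranclp_induct) (auto intro: rtranclp.rtrancl_into_rtrancl step_add)

lemma flip_neq:
  assumes "flip P m n"
  shows "m \<noteq> n"
proof
  assume "m = n"
  obtain p q t where "box P p q" and "m = E p + E q + t" "n = opp p q + t"
    using assms by (auto simp: flip_def)
  with \<open>m = n\<close> have "Poly_Mapping.lookup (E p + E q) p = Poly_Mapping.lookup (opp p q) p" by simp
  with box_distinct[OF \<open>box P p q\<close>] show False
    by (simp add: opp_def lookup_add lookup_single when_def prod_eq_iff split: if_splits)
qed

lemma flip_step: "flip P m n \<Longrightarrow> step P lt m n \<or> step P lt n m"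
  using grevlex_total[OF flip_neq] flip_sym by (auto simp: step_def)

lemma steps_grevlex: "(step P lt)\<^sup>*\<^sup>* m n \<Longrightarrow> m = n \<or> grevlex lt n m"
  by (induction rule: rtranclp_induct) (auto simp: step_def intro: grevlex_trans)

lemma equiv_flip_step: "equivclp (step P lt) m n \<longleftrightarrow> (flip P)\<^sup>*\<^sup>* m n"
proof -
  have "symclp (step P lt) = flip P"
    using flip_step flip_sym by (auto simp: fun_eq_iff symclp_def step_def)
  then show ?thesis by (simp add: equivclp_def)
qed

text \<open>Flips preserve the degree and introduce only variables of the polyomino, so that a monomial has
  finitely many descendants; their number decreases with each step.\<close>

lemma step_wf:
  assumes "finite (vertices P)"
  shows "wfP (step P lt)\<inverse>\<inverse>"
proof -
  let ?S = "\<lambda>m. {n. (step P lt)\<^sup>*\<^sup>* m n}"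
  have fin: "finite (?S m)" for m
  proof -
    have "total_degree n = total_degree m \<and> Poly_Mapping.keys n \<subseteq> vertices P \<union> Poly_Mapping.keys m"
      if "(step P lt)\<^sup>*\<^sup>* m n" for n
      using that
    proof (induction rule: rtranclp_induct)
      case (step y z)
      then show ?case
        using flip_degree[of P y z] flip_keys[of P y z] by (auto simp: step_def)
    qed simp
    then have "?S m \<subseteq> {n. Poly_Mapping.keys n \<subseteq> vertices P \<union> Poly_Mapping.keys m
      \<and> total_degree n = total_degree m}"
      by blast
    with finite_monomials_of_degree[of "vertices P \<union> Poly_Mapping.keys m"] assms show ?thesis
      by (meson finite_UnI finite_keys finite_subset)
  qed
  have "card (?S n) < card (?S m)" if "step P lt m n" for m n
  proof (rule psubset_card_mono[OF fin])
    have "m \<notin> ?S n"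
      using that steps_grevlex[of P n m] grevlex_asym grevlex_irrefl by (auto simp: step_def)
    moreover have "?S n \<subseteq> ?S m" using that by (auto intro: converse_rtranclp_into_rtranclp)
    ultimately show "?S n \<subset> ?S m" by blast
  qed
  then show ?thesis
    by (intro wfp_if_convertible_to_nat[of _ "\<lambda>m. card (?S m)"]) simp
qed

end

section \<open>Confluence for the rotated orders\<close>

text \<open>The two ends of a peak are joinable through a common neighbour unless both edges point away from
  it.\<close>

lemma diamond_closes:
  assumes "r a s \<or> r s a" "r b s \<or> r s b" "\<not> (r s a \<and> r s b)"
  shows "\<exists>z. r\<^sup>*\<^sup>* a z \<and> r\<^sup>*\<^sup>* b z"
  using assms by (meson r_into_rtranclp rtranclp.rtrancl_refl rtranclp_trans)

text \<open>Leading pairs without a common vertex reduce disjoint parts of the monomial.\<close>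

lemma monomial_overlap:
  fixes m t t' :: monomial
  assumes "E p + E q + t = E r + E s + t'" "{p, q} \<inter> {r, s} = {}" "p \<noteq> q" "r \<noteq> s"
  obtains w where "t = E r + E s + w" "t' = E p + E q + w"
proof
  let ?w = "t - (E r + E s)"
  have le: "Poly_Mapping.lookup (E r + E s) z \<le> Poly_Mapping.lookup t z" for z
    using arg_cong[OF assms(1), of "\<lambda>m. Poly_Mapping.lookup m z"] assms(2-)
    by (auto simp: lookup_add lookup_single when_def split: if_splits)
  show t: "t = E r + E s + ?w"
    using le by (intro poly_mapping_eqI) (simp add: lookup_add lookup_minus)
  have "(E r + E s) + t' = (E r + E s) + (E p + E q + ?w)"
    unfolding assms(1)[symmetric] by (subst t) (simp add: ac_simps)
  then show "t' = E p + E q + ?w" by simp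
qed

text \<open>The order \<open><\<^sup>k\<close> rotated at \<open>v\<close>, on a collection of cells for which the conditions of the
  combinatorial argument hold.\<close>

locale rotated_grid =
  fixes P :: "vertex set set" and k :: nat and v :: vertex
  assumes k: "k \<in> {1..8}"
    and grid: "grid (region P k) (range (xc k)) (range (yc k)) (xc k v, yc k v)"
begin

abbreviation "lt \<equiv> rotated (vertex_less k) v"

sublocale vertex_order lt
  by (rule vertex_order_rotated[OF vertex_order_vertex_less[OF k]])

interpretation grid "region P k" "range (xc k)" "range (yc k)" "(xc k v, yc k v)"
  by (rule grid)

abbreviation "red \<equiv> lead_pair P lt"

lemma red_commute: "red p q = red q p"
  by (simp add: lead_pair_def box_commute[of P p] opp_commute[of p] add.commute)

lemma box_iff_RB: "box P p q \<longleftrightarrow> xc k p \<noteq> xc k q \<and> yc k p \<noteq> yc k q \<and> RB (xc k p) (yc k p) (xc k q) (yc k q)"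
  unfolding RB_def by (rule box_iff_region)

lemma red_iff: "red p q \<longleftrightarrow> box P p q \<and> leads (xc k v, yc k v) (xc k p) (yc k p) (xc k q) (yc k q)"
proof (cases "box P p q")
  case True
  then have ne: "xc k p \<noteq> xc k q" "yc k p \<noteq> yc k q" by (auto simp: box_iff_RB)
  then have "p \<noteq> q" "corner k p q \<noteq> corner k q p" "{p, q} \<inter> {corner k p q, corner k q p} = {}"
    by (auto simp: vertex_eq_iff[of _ _ k])
  then have "grevlex lt (opp p q) (E p + E q) \<longleftrightarrow>
      leads (xc k v, yc k v) (xc k p) (yc k p) (xc k q) (yc k q)"
    unfolding opp_corner[of _ _ k] rotated_least_iff[OF k ne, symmetric] by (rule grevlex_pair_iff)
  with True show ?thesis by (simp add: lead_pair_def)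
qed (simp add: lead_pair_def)

lemma red_step: "red p q \<Longrightarrow> step P lt (E p + E q + t) (opp p q + t)"
  unfolding lead_pair_def step_def flip_def using grevlex_add_iff by blast

lemma step_iff_red: "step P lt m n \<longleftrightarrow> (\<exists>p q t. red p q \<and> m = E p + E q + t \<and> n = opp p q + t)"
  unfolding lead_pair_def step_def flip_def using grevlex_add_iff by blast

lemma step_red: "box P p q \<Longrightarrow> step P lt (E p + E q + t) (opp p q + t) \<Longrightarrow> red p q"
  unfolding lead_pair_def step_def using grevlex_add_iff by blast

lemma box_step: "box P p q \<Longrightarrow> step P lt (E p + E q + t) (opp p q + t)
  \<or> step P lt (opp p q + t) (E p + E q + t)"
  by (rule flip_step) (unfold flip_def, blast)

lemma peak_joinable:
  assumes up: "red u p" and uq: "red u q" and "p \<noteq> q"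
  shows "\<exists>z. (step P lt)\<^sup>*\<^sup>* (opp u p + E q) z \<and> (step P lt)\<^sup>*\<^sup>* (opp u q + E p) z"
proof -
  let ?X = "xc k" and ?Y = "yc k" and ?m = "corner k"
  note eqI = vertex_eq_iff[of _ _ k, THEN iffD2]
  have bp: "?X u \<noteq> ?X p" "?Y u \<noteq> ?Y p" "RB (?X u) (?Y u) (?X p) (?Y p)"
    and bq: "?X u \<noteq> ?X q" "?Y u \<noteq> ?Y q" "RB (?X u) (?Y u) (?X q) (?Y q)"
    using up uq by (simp_all add: red_iff box_iff_RB)
  consider "?X p = ?X q" "?Y p \<noteq> ?Y q" | "?X p \<noteq> ?X q" "?Y p = ?Y q" | "?X p \<noteq> ?X q" "?Y p \<noteq> ?Y q"
    using \<open>p \<noteq> q\<close> by (auto simp: vertex_eq_iff[of _ _ k])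
  then show ?thesis
  proof cases
    \<comment> \<open>Three rows and two columns: a third flip leads from one result to the other.\<close>
    case 1
    have "box P (?m u p) q"
      using 1 bp bq RB_third_row[of "?X u" "?Y u" "?X p" "?Y p" "?Y q"] by (simp add: box_iff_RB)
    from box_step[OF this, of "E (?m p u)"]
    have "step P lt (opp u p + E q) (opp u q + E p) \<or> step P lt (opp u q + E p) (opp u p + E q)"
      using 1 eqI[of "?m q p" p] eqI[of "?m q u" "?m p u"]
      by (simp add: opp_corner[of _ _ k] ac_simps)
    then show ?thesis by blast
  next
    case 2
    have "box P (?m p u) q"
      using 2 bp bq RB_third_column[of "?X u" "?Y u" "?X p" "?Y p" "?X q"] by (simp add: box_iff_RB)
    from box_step[OF this, of "E (?m u p)"]
    have "step P lt (opp u p + E q) (opp u q + E p) \<or> step P lt (opp u q + E p) (opp u p + E q)"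
      using 2 eqI[of "?m p q" p] eqI[of "?m u p" "?m u q"]
      by (simp add: opp_corner[of _ _ k] ac_simps)
    then show ?thesis by blast
  next
    case 3
    have closes: "closes (?X u) (?Y u) (?X p) (?Y p) (?X q) (?Y q)"
      using bp bq 3 up uq by (intro peak_closes) (auto simp: red_iff)
    note ne = bp(1,2) bq(1,2) 3 bp(1,2)[symmetric] bq(1,2)[symmetric] 3[symmetric]
    let ?a = "E (?m u p) + E (?m p u) + E q" and ?b = "E (?m u q) + E (?m q u) + E p"
    \<comment> \<open>\<open>?a\<close> and \<open>?b\<close> are the two results of the peak, \<open>?s\<close> and \<open>?s'\<close> their two common neighbours
      apart from the peak itself.\<close>
    let ?s = "E (?m u p) + E (?m p q) + E (?m q u)" and ?s' = "E (?m u q) + E (?m p u) + E (?m q p)"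
    have "\<exists>z. (step P lt)\<^sup>*\<^sup>* ?a z \<and> (step P lt)\<^sup>*\<^sup>* ?b z"
      using closes unfolding closes_def
    proof (elim disjE conjE)
      assume R: "RB (?X p) (?Y u) (?X q) (?Y q)" "RB (?X u) (?Y q) (?X p) (?Y p)"
        and nl: "\<not> (leads (?X v, ?Y v) (?X p) (?Y q) (?X q) (?Y u)
          \<and> leads (?X v, ?Y v) (?X u) (?Y p) (?X p) (?Y q))"
      have b1: "box P (?m p u) q" "box P (?m u q) p"
        using R ne by (simp_all add: box_iff_RB)
      have b2: "box P (?m p q) (?m q u)" "box P (?m u p) (?m p q)"
        using R ne by (simp_all add: box_iff_RB RB_def min.commute max.commute)
      show ?thesis
      proof (rule diamond_closes[of _ _ ?s])
        show "step P lt ?a ?s \<or> step P lt ?s ?a"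
          using box_step[OF b1(1), of "E (?m u p)"] by (simp add: opp_corner[of _ _ k] ac_simps)
        show "step P lt ?b ?s \<or> step P lt ?s ?b"
          using box_step[OF b1(2), of "E (?m q u)"] by (simp add: opp_corner[of _ _ k] ac_simps)
        show "\<not> (step P lt ?s ?a \<and> step P lt ?s ?b)"
          using nl step_red[OF b2(1), of "E (?m u p)"] step_red[OF b2(2), of "E (?m q u)"]
          by (auto simp: opp_corner[of _ _ k] ac_simps red_iff)
      qed
    next
      assume R: "RB (?X u) (?Y p) (?X q) (?Y q)" "RB (?X p) (?Y p) (?X q) (?Y u)"
        and nl: "\<not> (leads (?X v, ?Y v) (?X u) (?Y q) (?X q) (?Y p)
          \<and> leads (?X v, ?Y v) (?X p) (?Y u) (?X q) (?Y p))"
      have b1: "box P (?m u p) q" "box P p (?m q u)"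
        using R ne by (simp_all add: box_iff_RB)
      have b2: "box P (?m u q) (?m q p)" "box P (?m p u) (?m q p)"
        using R ne by (simp_all add: box_iff_RB RB_def min.commute max.commute)
      show ?thesis
      proof (rule diamond_closes[of _ _ ?s'])
        show "step P lt ?a ?s' \<or> step P lt ?s' ?a"
          using box_step[OF b1(1), of "E (?m p u)"] by (simp add: opp_corner[of _ _ k] ac_simps)
        show "step P lt ?b ?s' \<or> step P lt ?s' ?b"
          using box_step[OF b1(2), of "E (?m u q)"] by (simp add: opp_corner[of _ _ k] ac_simps)
        show "\<not> (step P lt ?s' ?a \<and> step P lt ?s' ?b)"
          using nl step_red[OF b2(1), of "E (?m p u)"] step_red[OF b2(2), of "E (?m u q)"]
          by (auto simp: opp_corner[of _ _ k] ac_simps red_iff)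
      qed
    qed
    then show ?thesis by (simp add: opp_corner[of _ _ k])
  qed
qed

lemma step_locally_confluent:
  assumes "step P lt m a" "step P lt m b"
  shows "\<exists>z. (step P lt)\<^sup>*\<^sup>* a z \<and> (step P lt)\<^sup>*\<^sup>* b z"
proof -
  obtain p q t where 1: "red p q" "m = E p + E q + t" "a = opp p q + t"
    using assms(1) by (auto simp: step_iff_red)
  obtain r s t' where 2: "red r s" "m = E r + E s + t'" "b = opp r s + t'"
    using assms(2) by (auto simp: step_iff_red)
  have ne: "p \<noteq> q" "r \<noteq> s"
    using 1(1) 2(1) by (auto simp: lead_pair_def dest: box_distinct)
  have share: "\<exists>z. (step P lt)\<^sup>*\<^sup>* (opp u p + t) z \<and> (step P lt)\<^sup>*\<^sup>* (opp u q + t') z"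
    if ups: "red u p" "red u q" "E u + E p + t = E u + E q + t'" for u p q t t'
  proof (cases "p = q")
    case True
    with ups show ?thesis by auto
  next
    case False
    have eq: "E p + t = E q + t'" using ups(3) by (simp add: add.assoc)
    define w where "w = t - E q"
    have "Poly_Mapping.lookup (E q) z \<le> Poly_Mapping.lookup t z" for z
    proof -
      have "Poly_Mapping.lookup (E p) z + Poly_Mapping.lookup t z
          = Poly_Mapping.lookup (E q) z + Poly_Mapping.lookup t' z"
        using eq by (metis lookup_add)
      with False show ?thesis
        by (cases "z = q") (simp_all add: lookup_single)
    qed
    then have t: "t = E q + w"
      unfolding w_def by (intro poly_mapping_eqI) (simp add: lookup_add lookup_minus)
    have "E q + t' = E q + (E p + w)"
      unfolding eq[symmetric] t by (simp add: ac_simps)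
    then have t': "t' = E p + w" by simp
    obtain z where "(step P lt)\<^sup>*\<^sup>* (opp u p + E q) z" "(step P lt)\<^sup>*\<^sup>* (opp u q + E p) z"
      using peak_joinable[OF ups(1,2) False] by blast
    then have "(step P lt)\<^sup>*\<^sup>* (opp u p + t) (z + w)" "(step P lt)\<^sup>*\<^sup>* (opp u q + t') (z + w)"
      unfolding t t' using steps_add[where w = w] by (simp_all add: add.assoc[symmetric])
    then show ?thesis by blast
  qed
  note rs = 2
  have p: "red q p" "m = E q + E p + t" "a = opp q p + t"
    using 1 by (simp_all only: red_commute[of q] opp_commute[of q] add.commute[of "E q"])
  have s: "red s r" "m = E s + E r + t'" "b = opp s r + t'"
    using 2 by (simp_all only: red_commute[of s] opp_commute[of s] add.commute[of "E s"])
  consider "{p, q} \<inter> {r, s} = {}" | "p = r" | "p = s" | "q = r" | "q = s" by blast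
  then show ?thesis
  proof cases
    case disjoint: 1
    obtain w where w: "t = E r + E s + w" "t' = E p + E q + w"
      using monomial_overlap[of p q t r s t'] 1(2) 2(2) disjoint ne by metis
    have "step P lt a (opp r s + (opp p q + w))" "step P lt b (opp p q + (opp r s + w))"
      using red_step[OF 2(1), of "opp p q + w"] red_step[OF 1(1), of "opp r s + w"] 1(3) 2(3) w
      by (simp_all add: ac_simps)
    then show ?thesis by (metis add.left_commute r_into_rtranclp)
  next
    case 2
    show ?thesis using share[of p q s t t'] 1 rs 2 by simp
  next
    case 3
    show ?thesis using share[of p q r t t'] 1 s 3 by simp
  next
    case 4
    show ?thesis using share[of q p s t t'] p rs 4 by simp
  next
    case 5
    show ?thesis using share[of q p r t t'] p s 5 by simp
  qed
qed

lemma flip_joinable: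
  assumes "finite (vertices P)" "(flip P)\<^sup>*\<^sup>* m n"
  shows "\<exists>z. (step P lt)\<^sup>*\<^sup>* m z \<and> (step P lt)\<^sup>*\<^sup>* n z"
proof -
  have "confluentp (step P lt)"
    using step_wf[OF assms(1)] step_locally_confluent by (rule newman)
  then have "semiconfluentp (step P lt)" by (rule confluentp_imp_semiconfluentp)
  moreover have "equivclp (step P lt) m n" using assms(2) by (simp add: equiv_flip_step)
  ultimately show ?thesis
    by (auto simp: semiconfluentp_equivclp rtranclp_conversep)
qed

end

section \<open>Push-forward of polynomials along a map of monomials\<close>

lemma pol_decomp: "(\<Sum>m\<in>Poly_Mapping.keys f. Poly_Mapping.single m (Poly_Mapping.lookup f m)) = f"
  by (intro poly_mapping_eqI)
    (simp add: lookup_sum lookup_single when_def sum.delta in_keys_iff)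

text \<open>The image of a polynomial under the linear map that sends the monomial \<open>m\<close> to \<open>h m\<close>. Its value
  at \<open>c\<close> is the sum of the coefficients of \<open>f\<close> over the fibre of \<open>h\<close> over \<open>c\<close>.\<close>

definition push :: "('a \<Rightarrow> 'c) \<Rightarrow> ('a \<Rightarrow>\<^sub>0 'k::comm_ring_1) \<Rightarrow> ('c \<Rightarrow>\<^sub>0 'k)" where
  "push h f = (\<Sum>m\<in>Poly_Mapping.keys f. Poly_Mapping.single (h m) (Poly_Mapping.lookup f m))"

lemma push_superset:
  assumes "finite A" "Poly_Mapping.keys f \<subseteq> A"
  shows "push h f = (\<Sum>m\<in>A. Poly_Mapping.single (h m) (Poly_Mapping.lookup f m))"
  unfolding push_def using assms by (intro sum.mono_neutral_left) (auto simp: in_keys_iff)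

lemma push_zero [simp]: "push h 0 = 0"
  by (simp add: push_def)

lemma push_add: "push h (f + g) = push h f + push h g"
proof -
  let ?A = "Poly_Mapping.keys f \<union> Poly_Mapping.keys g"
  have "push h (f + g) = (\<Sum>m\<in>?A. Poly_Mapping.single (h m) (Poly_Mapping.lookup (f + g) m))"
    using Poly_Mapping.keys_add[of f g] by (intro push_superset) auto
  also have "\<dots> = push h f + push h g"
    using push_superset[of ?A f h] push_superset[of ?A g h]
    by (simp add: lookup_add single_add sum.distrib)
  finally show ?thesis .
qed

lemma push_sum: "push h (sum f A) = (\<Sum>a\<in>A. push h (f a))"
  by (induction A rule: infinite_finite_induct) (simp_all add: push_add)

lemma push_single [simp]: "push h (Poly_Mapping.single m c) = Poly_Mapping.single (h m) c"
  by (cases "c = 0") (simp_all add: push_def)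

lemma push_diff: "push h (f - g) = push h f - push h g"
  using push_add[of h "f - g" g] by simp

lemma lookup_push:
  "Poly_Mapping.lookup (push h f) c = (\<Sum>m\<in>{m \<in> Poly_Mapping.keys f. h m = c}. Poly_Mapping.lookup f m)"
  unfolding push_def
  by (simp add: lookup_sum lookup_single when_def sum.inter_filter)

lemma push_push: "push g (push h f) = push (\<lambda>m. g (h m)) f"
  unfolding push_def[of h] push_def[of "\<lambda>m. g (h m)"] by (simp add: push_sum)

lemma push_cong:
  assumes "\<And>m. m \<in> Poly_Mapping.keys f \<Longrightarrow> h m = h' m"
  shows "push h f = push h' f"
  unfolding push_def using assms by (intro sum.cong) auto

text \<open>On the monomials of \<open>f\<close>, the map \<open>h'\<close> factors through \<open>h\<close>.\<close>

lemma push_eq_0_factor: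
  assumes "push h f = 0" "\<And>m n. m \<in> Poly_Mapping.keys f \<Longrightarrow> n \<in> Poly_Mapping.keys f \<Longrightarrow> h m = h n \<Longrightarrow> h' m = h' n"
  shows "push h' f = 0"
proof -
  let ?g = "\<lambda>c. h' (SOME m. m \<in> Poly_Mapping.keys f \<and> h m = c)"
  have "push h' f = push (\<lambda>m. ?g (h m)) f"
  proof (rule push_cong)
    fix m assume m: "m \<in> Poly_Mapping.keys f"
    let ?n = "SOME n. n \<in> Poly_Mapping.keys f \<and> h n = h m"
    have "?n \<in> Poly_Mapping.keys f \<and> h ?n = h m"
      using m by (intro someI[of "\<lambda>n. n \<in> Poly_Mapping.keys f \<and> h n = h m" m]) simp
    then show "h' m = ?g (h m)" using m by (intro assms(2)) auto
  qed
  also have "\<dots> = push ?g (push h f)" by (simp only: push_push)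
  finally show ?thesis by (simp add: assms(1))
qed

lemma push_single_times:
  "push h (Poly_Mapping.single t c * f)
    = (\<Sum>m\<in>Poly_Mapping.keys f. Poly_Mapping.single (h (t + m)) (c * Poly_Mapping.lookup f m))"
  by (subst pol_decomp[of f, symmetric]) (simp only: sum_distrib_left mult_single push_sum push_single)

text \<open>If the fibres of \<open>h\<close> are the classes of a congruence, the polynomials killed by \<open>push h\<close> are
  closed under multiplication.\<close>

lemma push_eq_0_times:
  assumes "push h f = 0" "\<And>m n t. h m = h n \<Longrightarrow> h (t + m) = h (t + n)"
  shows "push h (p * f) = 0"
proof -
  have "push h (Poly_Mapping.single t c * f) = 0" for t c
  proof -
    have "push (\<lambda>m. h (t + m)) f = 0"
      using assms by (rule push_eq_0_factor)
    then have "Poly_Mapping.lookup (push (\<lambda>m. h (t + m)) f) d = 0" for d by simp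
    then have "(\<Sum>m\<in>{m \<in> Poly_Mapping.keys f. h (t + m) = d}. c * Poly_Mapping.lookup f m) = 0" for d
      unfolding lookup_push sum_distrib_left[symmetric] by simp
    then show ?thesis
      unfolding push_single_times
      by (intro poly_mapping_eqI) (simp add: lookup_sum lookup_single when_def sum.inter_filter)
  qed
  then show ?thesis
    by (subst pol_decomp[of p, symmetric]) (simp only: sum_distrib_right push_sum sum.neutral_const)
qed

lemma push_times:
  assumes "\<And>m n. h (m + n) = h m + h n"
  shows "push h (f * g) = push h f * push h g"
proof -
  have "push h (Poly_Mapping.single t c * g) = Poly_Mapping.single (h t) c * push h g" for t c
    unfolding push_single_times assms push_def[of h g] by (simp add: sum_distrib_left mult_single)
  then show ?thesis
    by (subst (1 2) pol_decomp[of f, symmetric]) (simp only: sum_distrib_right push_sum push_single)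
qed

section \<open>Ideals of the polynomial ring\<close>

lemma poly_ring_simps [simp]:
  "mult (poly_ring V) = (*)" "one (poly_ring V) = 1" "zero (poly_ring V) = 0" "add (poly_ring V) = (+)"
  by (simp_all add: poly_ring_def)

lemma poly_ring_carrier: "f \<in> carrier (poly_ring V) \<longleftrightarrow> (\<forall>m\<in>Poly_Mapping.keys f. Poly_Mapping.keys m \<subseteq> V)"
  by (simp add: poly_ring_def)

lemma ring_poly_ring: "ring (poly_ring V :: ('k::field) pol ring)"
  using cring_poly_ring cring.axioms(1) by blast

lemma poly_ring_uminus: "f \<in> carrier (poly_ring V) \<Longrightarrow> - f \<in> carrier (poly_ring V)"
  by (simp add: poly_ring_carrier)

lemma poly_ring_times: "f \<in> carrier (poly_ring V) \<Longrightarrow> g \<in> carrier (poly_ring V) \<Longrightarrow> f * g \<in> carrier (poly_ring V)"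
  using monoid.m_closed[OF ring.is_monoid[OF ring_poly_ring[of V]], of f g] by simp

lemma poly_ring_add: "f \<in> carrier (poly_ring V) \<Longrightarrow> g \<in> carrier (poly_ring V) \<Longrightarrow> f + g \<in> carrier (poly_ring V)"
  using abelian_monoid.a_closed[OF abelian_group.axioms(1)[OF ring.is_abelian_group[OF ring_poly_ring[of V]]], of f g] by simp

lemma a_inv_poly_ring: "f \<in> carrier (poly_ring V) \<Longrightarrow> a_inv (poly_ring V) f = - f"
  using abelian_group.minus_equality[OF ring.is_abelian_group[OF ring_poly_ring[of V]], of "- f" f]
    poly_ring_uminus[of f V] by simp

lemma poly_ring_idealI:
  fixes I :: "('k::field) pol set"
  assumes "I \<subseteq> carrier (poly_ring V)" "0 \<in> I" "\<And>f g. f \<in> I \<Longrightarrow> g \<in> I \<Longrightarrow> f + g \<in> I"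
    and times: "\<And>p f. p \<in> carrier (poly_ring V) \<Longrightarrow> f \<in> I \<Longrightarrow> p * f \<in> I"
  shows "ideal I (poly_ring V)"
proof (rule idealI[OF ring_poly_ring])
  have "- f \<in> I" if "f \<in> I" for f
    using times[of "-1" f] that by (simp add: poly_ring_carrier)
  then have "a_inv (poly_ring V) f \<in> I" if "f \<in> I" for f
    using that assms(1) by (subst a_inv_poly_ring) auto
  then show "subgroup I (add_monoid (poly_ring V))"
    using assms(1-3) by (intro subgroup.intro) (simp_all add: a_inv_def)
next
  fix f p :: "'k pol"
  assume "f \<in> I" "p \<in> carrier (poly_ring V)"
  with times[of p f] show "p \<otimes>\<^bsub>poly_ring V\<^esub> f \<in> I" "f \<otimes>\<^bsub>poly_ring V\<^esub> p \<in> I"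
    by (simp_all add: mult.commute)
qed

lemma poly_ring_idealD:
  fixes I :: "('k::field) pol set"
  assumes "ideal I (poly_ring V)"
  shows "0 \<in> I" "\<And>f g. f \<in> I \<Longrightarrow> g \<in> I \<Longrightarrow> f + g \<in> I" "\<And>f. f \<in> I \<Longrightarrow> - f \<in> I"
    "\<And>p f. p \<in> carrier (poly_ring V) \<Longrightarrow> f \<in> I \<Longrightarrow> p * f \<in> I" "I \<subseteq> carrier (poly_ring V)"
proof -
  interpret ideal I "poly_ring V" by fact
  show 1: "0 \<in> I" "\<And>f g. f \<in> I \<Longrightarrow> g \<in> I \<Longrightarrow> f + g \<in> I" "I \<subseteq> carrier (poly_ring V)"
    "\<And>p f. p \<in> carrier (poly_ring V) \<Longrightarrow> f \<in> I \<Longrightarrow> p * f \<in> I"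
    using additive_subgroup.zero_closed[OF additive_subgroup_axioms]
      additive_subgroup.a_closed[OF additive_subgroup_axioms] a_subset I_l_closed by auto
  show "- f \<in> I" if "f \<in> I" for f
    using 1(4)[of "-1" f] that by (simp add: poly_ring_carrier)
qed

lemma poly_ring_ideal_sum:
  assumes "ideal I (poly_ring V)" "\<And>a. a \<in> A \<Longrightarrow> f a \<in> I"
  shows "sum f A \<in> I"
  using assms(2) by (induction A rule: infinite_finite_induct) (auto simp: poly_ring_idealD[OF assms(1)])

lemma genideal_poly_ring:
  assumes "S \<subseteq> carrier (poly_ring V)"
  shows "ideal (Idl\<^bsub>poly_ring V\<^esub> S) (poly_ring V)" "S \<subseteq> Idl\<^bsub>poly_ring V\<^esub> S"
  using ring.genideal_ideal[OF ring_poly_ring assms] ring.genideal_self[OF ring_poly_ring assms] .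

lemma genideal_poly_ring_minimal: "ideal I (poly_ring V) \<Longrightarrow> S \<subseteq> I \<Longrightarrow> Idl\<^bsub>poly_ring V\<^esub> S \<subseteq> I"
  by (rule ring.genideal_minimal[OF ring_poly_ring])

section \<open>The polyomino ideal and flip classes\<close>

text \<open>The class of a monomial for the equivalence relation that is generated by flips.\<close>

definition flip_class :: "vertex set set \<Rightarrow> monomial \<Rightarrow> monomial set" where
  "flip_class P m = {n. (flip P)\<^sup>*\<^sup>* m n}"

lemma flips_sym: "(flip P)\<^sup>*\<^sup>* m n \<Longrightarrow> (flip P)\<^sup>*\<^sup>* n m"
  using symp_rtranclp[of "flip P"] flip_sym by (metis sympD sympI)

lemma flips_add: "(flip P)\<^sup>*\<^sup>* m n \<Longrightarrow> (flip P)\<^sup>*\<^sup>* (m + w) (n + w)"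
  by (induction rule: rtranclp_induct) (auto intro: rtranclp.rtrancl_into_rtrancl flip_add)

lemma flip_class_eq_iff: "flip_class P m = flip_class P n \<longleftrightarrow> (flip P)\<^sup>*\<^sup>* m n"
  unfolding flip_class_def using flips_sym by (auto; metis rtranclp_trans rtranclp.rtrancl_refl mem_Collect_eq)

lemma flip_class_add: "flip_class P m = flip_class P n \<Longrightarrow> flip_class P (t + m) = flip_class P (t + n)"
  unfolding flip_class_eq_iff using flips_add[of P m n t] by (simp add: add.commute)

lemma flips_keys:
  assumes "(flip P)\<^sup>*\<^sup>* m n" "Poly_Mapping.keys m \<subseteq> vertices P"
  shows "Poly_Mapping.keys n \<subseteq> vertices P"
  using assms by (induction rule: rtranclp_induct) (use flip_keys in blast)+

text \<open>The monomial with exponent \<open>m\<close> as a polynomial.\<close>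

abbreviation X :: "monomial \<Rightarrow> ('k::field) pol" where "X m \<equiv> Poly_Mapping.single m 1"

text \<open>The minor of the rectangle with opposite corners \<open>p\<close>, \<open>q\<close>, with the sign for which the term of
  \<open>p\<close> and \<open>q\<close> has coefficient \<open>1\<close>.\<close>

definition binomial :: "vertex \<Rightarrow> vertex \<Rightarrow> ('k::field) pol" where
  "binomial p q = X (E p + E q) - X (opp p q)"

lemma binomial_commute: "binomial p q = binomial q p"
  by (simp add: binomial_def opp_commute[of p] add.commute)

lemma binomial_corners: "binomial (fst p, snd q) (fst q, snd p) = - binomial p q"
  by (simp add: binomial_def opp_def)

lemma minor_eq_binomial: "minor a b = binomial a b"
  by (simp add: minor_def var_def monom_pol_def binomial_def opp_def mult_single)

lemma inner_interval_box: "inner_interval P a b \<Longrightarrow> box P a b"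
  by (auto simp: box_def inner_interval_iff)

lemma inner_minors_subset: "inner_minors P \<subseteq> {binomial p q | p q. box P p q}"
  unfolding inner_minors_def minor_eq_binomial using inner_interval_box by blast

lemma binomial_minor:
  assumes "box P p q"
  shows "binomial p q \<in> (inner_minors P :: ('k::field) pol set)
    \<or> - binomial p q \<in> (inner_minors P :: 'k pol set)"
proof -
  let ?b = "binomial :: vertex \<Rightarrow> vertex \<Rightarrow> 'k pol"
  let ?l = "(min (fst p) (fst q), min (snd p) (snd q))" and ?u = "(max (fst p) (fst q), max (snd p) (snd q))"
  have "inner_interval P ?l ?u" using assms by (simp add: box_def)
  then have "?b ?l ?u \<in> inner_minors P"
    unfolding inner_minors_def minor_eq_binomial by blast
  moreover have "?b ?l ?u = ?b p q \<or> ?b ?l ?u = - ?b p q"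
  proof -
    consider "?l = p" "?u = q" | "?l = q" "?u = p" | "?l = (fst p, snd q)" "?u = (fst q, snd p)"
      | "?l = (fst q, snd p)" "?u = (fst p, snd q)"
      by (cases "fst p \<le> fst q"; cases "snd p \<le> snd q") (auto simp: min_def max_def prod_eq_iff)
    then show ?thesis
      by cases (simp_all only: binomial_commute[of q p] binomial_corners
        binomial_commute[of "(fst q, snd p)"] simp_thms)
  qed
  ultimately show ?thesis by metis
qed

lemma binomial_carrier: "box P p q \<Longrightarrow> binomial p q \<in> carrier (poly_ring (vertices P))"
  using box_vertices[of P p q]
  by (auto simp: poly_ring_carrier binomial_def opp_def keys_add_nat in_keys_iff[of _ "X _ - X _"]
    lookup_minus
      lookup_single when_def split: if_splits)

lemma polyomino_ideal_ideal: "ideal (polyomino_ideal P :: ('k::field) pol set) (poly_ring (vertices P))"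
  and inner_minors_in_ideal: "inner_minors P \<subseteq> (polyomino_ideal P :: ('k::field) pol set)"
proof -
  have "inner_minors P \<subseteq> carrier (poly_ring (vertices P) :: 'k pol ring)"
    using inner_minors_subset binomial_carrier by blast
  then show "ideal (polyomino_ideal P :: 'k pol set) (poly_ring (vertices P))"
    "inner_minors P \<subseteq> (polyomino_ideal P :: 'k pol set)"
    unfolding polyomino_ideal_def by (rule genideal_poly_ring)+
qed

lemma binomial_in_ideal:
  assumes "box P p q"
  shows "binomial p q \<in> (polyomino_ideal P :: ('k::field) pol set)"
proof -
  have "binomial p q \<in> (polyomino_ideal P :: 'k pol set) \<or> - binomial p q \<in> (polyomino_ideal P :: 'k pol set)"
    using binomial_minor[OF assms] inner_minors_in_ideal[of P] by blast
  then show ?thesis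
    using poly_ring_idealD(3)[OF polyomino_ideal_ideal, of "- binomial p q" P] by auto
qed

lemma flips_in_ideal:
  assumes "(flip P)\<^sup>*\<^sup>* m n" "Poly_Mapping.keys m \<subseteq> vertices P"
  shows "X m - X n \<in> (polyomino_ideal P :: ('k::field) pol set)"
  using assms(1)
proof (induction rule: rtranclp_induct)
  case base
  show ?case using poly_ring_idealD(1)[OF polyomino_ideal_ideal] by simp
next
  case (step n n')
  obtain p q t where b: "box P p q" and n: "n = E p + E q + t" "n' = opp p q + t"
    using step.hyps(2) by (auto simp: flip_def)
  have "Poly_Mapping.keys n \<subseteq> vertices P" using flips_keys[OF step.hyps(1) assms(2)] .
  then have "X t \<in> carrier (poly_ring (vertices P) :: 'k pol ring)"
    by (simp add: poly_ring_carrier n keys_add_nat)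
  then have "X t * binomial p q \<in> (polyomino_ideal P :: 'k pol set)"
    using poly_ring_idealD(4)[OF polyomino_ideal_ideal] binomial_in_ideal[OF b] by blast
  also have "X t * binomial p q = (X n - X n' :: 'k pol)"
    by (simp add: binomial_def n right_diff_distrib mult_single add.commute)
  finally have "X m - X n + (X n - X n') \<in> (polyomino_ideal P :: 'k pol set)"
    using step.IH poly_ring_idealD(2)[OF polyomino_ideal_ideal] by blast
  then show ?case by simp
qed

text \<open>A polynomial whose coefficients sum to zero over each flip class is a combination of the
  differences between its monomials and representatives of their classes.\<close>

lemma polyomino_ideal_eq:
  "polyomino_ideal P = {f \<in> carrier (poly_ring (vertices P)). push (flip_class P) f = (0 :: _ \<Rightarrow>\<^sub>0 'k::field)}"
    (is "?I = ?K")
proof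
  have "ideal ?K (poly_ring (vertices P))"
    using push_eq_0_times[of "flip_class P", OF _ flip_class_add]
    by (intro poly_ring_idealI) (auto simp: push_add poly_ring_add poly_ring_times, simp add: poly_ring_carrier)
  moreover have "inner_minors P \<subseteq> ?K"
  proof
    fix f :: "'k pol" assume "f \<in> inner_minors P"
    then obtain p q where f: "f = binomial p q" and b: "box P p q"
      using inner_minors_subset by blast
    have "flip P (E p + E q) (opp p q)"
      unfolding flip_def using b by (metis add.right_neutral)
    then have "flip_class P (E p + E q) = flip_class P (opp p q)"
      by (simp only: flip_class_eq_iff r_into_rtranclp)
    then have "push (flip_class P) f = 0"
      by (simp add: f binomial_def push_diff)
    with binomial_carrier[OF b] show "f \<in> ?K" by (simp add: f)
  qed
  ultimately show "?I \<subseteq> ?K"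
    unfolding polyomino_ideal_def by (rule genideal_poly_ring_minimal)
next
  show "?K \<subseteq> ?I"
  proof
    fix f :: "'k pol" assume f: "f \<in> ?K"
    \<comment> \<open>Replace every monomial by a representative of its class; all coefficients then cancel.\<close>
    let ?r = "\<lambda>m. SOME n. n \<in> flip_class P m"
    have "push ?r f = push (\<lambda>C. SOME n. n \<in> C) (push (flip_class P) f)" by (simp only: push_push)
    then have "push ?r f = 0" using f by simp
    then have "f = f - push ?r f" by simp
    also have "\<dots>
      = (\<Sum>m\<in>Poly_Mapping.keys f. Poly_Mapping.single 0 (Poly_Mapping.lookup f m) * (X m - X (?r m)))"
      unfolding right_diff_distrib sum_subtractf mult_single push_def by (simp add: pol_decomp)
    also have "\<dots> \<in> ?I"
    proof (intro poly_ring_ideal_sum[OF polyomino_ideal_ideal]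
      poly_ring_idealD(4)[OF polyomino_ideal_ideal] flips_in_ideal)
      fix m assume m: "m \<in> Poly_Mapping.keys f"
      show "Poly_Mapping.keys m \<subseteq> vertices P" using f m by (simp add: poly_ring_carrier)
      have "?r m \<in> flip_class P m" by (rule someI[of _ m]) (simp add: flip_class_def)
      then show "(flip P)\<^sup>*\<^sup>* m (?r m)" by (simp add: flip_class_def)
      show "Poly_Mapping.single 0 (Poly_Mapping.lookup f m) \<in> carrier (poly_ring (vertices P))"
        by (simp add: poly_ring_carrier)
    qed
    finally show "f \<in> ?I" .
  qed
qed

section \<open>Groebner bases and common descendants\<close>

lemma monomial_ideal_dvd:
  fixes f :: "('k::field) pol"
  assumes "f \<in> Idl\<^bsub>poly_ring V\<^esub> {X l | l. l \<in> L}" "\<And>l. l \<in> L \<Longrightarrow> Poly_Mapping.keys l \<subseteq> V"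
    "m \<in> Poly_Mapping.keys f"
  shows "\<exists>l\<in>L. mono_dvd l m"
proof -
  let ?K = "{f \<in> carrier (poly_ring V) :: 'k pol set. \<forall>m\<in>Poly_Mapping.keys f. \<exists>l\<in>L. mono_dvd l m}"
  have "ideal ?K (poly_ring V)"
  proof (rule poly_ring_idealI)
    show "f + g \<in> ?K" if "f \<in> ?K" "g \<in> ?K" for f g
      using that Poly_Mapping.keys_add[of f g] by (auto simp: poly_ring_add)
    show "p * f \<in> ?K" if "p \<in> carrier (poly_ring V)" "f \<in> ?K" for p f
    proof -
      have "\<exists>l\<in>L. mono_dvd l m" if m: "m \<in> Poly_Mapping.keys (p * f)" for m
      proof -
        obtain a b where "m = a + b" "b \<in> Poly_Mapping.keys f"
          using m Poly_Mapping.keys_mult[of p f] by blast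
        moreover obtain l where "l \<in> L" "mono_dvd l b"
          using \<open>f \<in> ?K\<close> \<open>b \<in> _\<close> by blast
        ultimately show ?thesis
          unfolding mono_dvd_def by (metis add.left_commute)
      qed
      with that show ?thesis by (simp add: poly_ring_times)
    qed
  qed (auto simp: poly_ring_carrier)
  moreover have "mono_dvd l l" for l
    unfolding mono_dvd_def by (metis add.right_neutral)
  then have "X l \<in> ?K" if "l \<in> L" for l
    using assms(2)[OF that] that by (auto simp: poly_ring_carrier)
  then have "{X l | l. l \<in> L} \<subseteq> ?K" by blast
  ultimately have "Idl\<^bsub>poly_ring V\<^esub> {X l | l. l \<in> L} \<subseteq> ?K"
    by (rule genideal_poly_ring_minimal)
  with assms(1) have "f \<in> ?K" by (rule subsetD[rotated])
  with assms(3) show ?thesis by blast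
qed

text \<open>In characteristic two both signs of a minor have leading coefficient \<open>1\<close>, but then they agree.\<close>

lemma uminus_char_2: "(- 1 :: 'k::field) = 1 \<Longrightarrow> - f = (f :: 'a \<Rightarrow>\<^sub>0 'k)"
  by (intro poly_mapping_eqI) (metis lookup_uminus mult_minus1 mult_1)

lemma pair_dvd_iff:
  assumes "p \<noteq> q"
  shows "mono_dvd (E p + E q) m \<longleftrightarrow> p \<in> Poly_Mapping.keys m \<and> q \<in> Poly_Mapping.keys m"
proof
  show "mono_dvd (E p + E q) m \<Longrightarrow> p \<in> Poly_Mapping.keys m \<and> q \<in> Poly_Mapping.keys m"
    by (auto simp: mono_dvd_def keys_add_nat)
  assume *: "p \<in> Poly_Mapping.keys m \<and> q \<in> Poly_Mapping.keys m"
  have "m = (E p + E q) + (m - (E p + E q))"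
  proof (rule poly_mapping_eqI)
    fix z
    have "Poly_Mapping.lookup (E p + E q) z \<le> Poly_Mapping.lookup m z"
      using * assms by (auto simp: lookup_add lookup_single when_def in_keys_iff)
    then show "Poly_Mapping.lookup m z = Poly_Mapping.lookup (E p + E q + (m - (E p + E q))) z"
      by (simp add: lookup_add lookup_minus)
  qed
  then show "mono_dvd (E p + E q) m" unfolding mono_dvd_def ..
qed

lemma lead_mono_uminus: "lead_mono lt (- f) = lead_mono lt f"
  by (simp add: lead_mono_def)

context vertex_order
begin

lemma lead_pair_cases:
  assumes "box P p q"
  shows "lead_pair P lt p q \<or> lead_pair P lt (fst p, snd q) (fst q, snd p)"
proof -
  have "flip P (E p + E q) (opp p q)"
    unfolding flip_def using assms by (metis add.right_neutral)
  then have "grevlex lt (opp p q) (E p + E q) \<or> grevlex lt (E p + E q) (opp p q)"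
    using grevlex_total[OF flip_neq] by blast
  then show ?thesis
    using assms by (auto simp: lead_pair_def box_corners opp_corners opp_def)
qed

lemma step_lead_pair:
  assumes "step P lt m n"
  obtains p q t where "lead_pair P lt p q" "m = E p + E q + t" "n = opp p q + t"
proof -
  obtain p q t where "box P p q" and mn: "m = E p + E q + t" "n = opp p q + t" and "grevlex lt n m"
    using assms by (auto simp: step_def flip_def)
  then have "lead_pair P lt p q"
    unfolding lead_pair_def by (simp only: mn grevlex_add_iff)
  then show thesis using that mn by blast
qed

lemma keys_binomial:
  assumes "lead_pair P lt p q"
  shows "Poly_Mapping.keys (binomial p q :: ('k::field) pol) = {E p + E q, opp p q}"
  using assms grevlex_irrefl[of "opp p q"]
  by (auto simp: binomial_def lead_pair_def in_keys_iff lookup_minus lookup_single when_def split: if_splits)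

lemma lead_mono_binomial:
  assumes "lead_pair P lt p q"
  shows "lead_mono (grevlex lt) (binomial p q :: ('k::field) pol) = E p + E q"
  using assms keys_binomial[OF assms, where 'k = 'k]
  by (intro lead_mono_eqI) (auto simp: grevlex_asym lead_pair_def)

lemma lead_coeff_binomial:
  assumes "lead_pair P lt p q"
  shows "lead_coeff (grevlex lt) (binomial p q :: ('k::field) pol) = 1"
  unfolding lead_coeff_def lead_mono_binomial[OF assms] using assms grevlex_irrefl[of "opp p q"]
  by (auto simp: binomial_def lookup_minus lookup_single when_def lead_pair_def)

text \<open>The minors, normalised to leading coefficient \<open>1\<close>, are indexed by the leading pairs.\<close>

lemma signed_inner_minors_eq:
  "signed_inner_minors (grevlex lt) P = {binomial p q :: ('k::field) pol | p q. lead_pair P lt p q}"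
proof -
  let ?sgn = "\<lambda>f :: 'k pol. if lead_coeff (grevlex lt) f = 1 then f else - f"
  have sgn: "?sgn (binomial p q) = binomial p q" "?sgn (- binomial p q) = binomial p q"
    if "lead_pair P lt p q" for p q
    using lead_coeff_binomial[OF that, where 'k = 'k] uminus_char_2[of "binomial p q :: 'k pol"]
    by (auto simp: lead_coeff_def lead_mono_uminus)
  show ?thesis
    unfolding signed_inner_minors_def
  proof (intro equalityI subsetI)
    fix g assume "g \<in> ?sgn ` inner_minors P"
    then obtain p q where g: "g = ?sgn (binomial p q)" and b: "box P p q"
      using inner_minors_subset by blast
    from lead_pair_cases[OF b] show "g \<in> {binomial p q | p q. lead_pair P lt p q}"
    proof
      assume l: "lead_pair P lt p q"
      with sgn(1)[OF l] g show ?thesis by blast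
    next
      assume l: "lead_pair P lt (fst p, snd q) (fst q, snd p)"
      have "g = binomial (fst p, snd q) (fst q, snd p)"
        using sgn(2)[OF l] g unfolding binomial_corners minus_minus by simp
      with l show ?thesis by blast
    qed
  next
    fix g :: "'k pol" assume "g \<in> {binomial p q | p q. lead_pair P lt p q}"
    then obtain p q where g: "g = binomial p q" and l: "lead_pair P lt p q" by blast
    then have "g \<in> inner_minors P \<or> - g \<in> inner_minors P"
      using binomial_minor lead_pair_def by blast
    then show "g \<in> ?sgn ` inner_minors P"
      using sgn[OF l] unfolding g by (elim disjE) (rule image_eqI, rule sym, assumption+)+
  qed
qed

lemma lead_mono_keys:
  fixes f :: "('k::field) pol"
  assumes "f \<in> polyomino_ideal P" "f \<noteq> 0"
  shows "Poly_Mapping.keys (lead_mono (grevlex lt) f) \<subseteq> vertices P"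
proof -
  have "f \<in> carrier (poly_ring (vertices P))"
    using poly_ring_idealD(5)[OF polyomino_ideal_ideal] assms(1) by blast
  then show ?thesis
    using lead_mono_max(1)[OF assms(2)] by (simp add: poly_ring_carrier)
qed

lemma lead_monos_carrier:
  "{monom_pol (lead_mono (grevlex lt) f) | f. f \<in> (polyomino_ideal P :: ('k::field) pol set) \<and> f \<noteq> 0}
    \<subseteq> carrier (poly_ring (vertices P) :: 'k pol ring)"
proof
  fix x :: "'k pol"
  assume "x \<in> {monom_pol (lead_mono (grevlex lt) f) | f. f \<in> (polyomino_ideal P :: 'k pol set) \<and> f \<noteq> 0}"
  then obtain f :: "'k pol" where f: "f \<in> polyomino_ideal P" "f \<noteq> 0"
    "x = monom_pol (lead_mono (grevlex lt) f)"
    by blast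
  from lead_mono_keys[OF f(1,2)] show "x \<in> carrier (poly_ring (vertices P) :: 'k pol ring)"
    by (simp add: f(3) monom_pol_def poly_ring_carrier)
qed

text \<open>Of the Groebner basis for the unrotated order, only this consequence is used.\<close>

lemma groebner_lead_dvd:
  fixes f :: "('k::field) pol"
  assumes gb: "groebner_basis (vertices P) (grevlex lt) (signed_inner_minors (grevlex lt) P) (polyomino_ideal P :: 'k pol set)"
    and f: "f \<in> polyomino_ideal P" "f \<noteq> 0"
  shows "\<exists>p q. lead_pair P lt p q \<and> mono_dvd (E p + E q) (lead_mono (grevlex lt) f)"
proof -
  let ?I = "polyomino_ideal P :: 'k pol set" and ?R = "poly_ring (vertices P) :: 'k pol ring"
  have keys: "Poly_Mapping.keys (lead_mono (grevlex lt) g) \<subseteq> vertices P" if "g \<in> ?I" "g \<noteq> 0" for g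
    using lead_mono_keys[OF that] .
  from genideal_poly_ring(2)[OF lead_monos_carrier] f
  have "X (lead_mono (grevlex lt) f) \<in> initial_ideal (vertices P) (grevlex lt) ?I"
    unfolding initial_ideal_def monom_pol_def by blast
  also have "\<dots> = Idl\<^bsub>?R\<^esub> {X l | l. l \<in> lead_mono (grevlex lt) ` (signed_inner_minors (grevlex lt) P :: 'k pol set)}"
  proof -
    have "{monom_pol (lead_mono (grevlex lt) g) | g. g \<in> (signed_inner_minors (grevlex lt) P :: 'k pol set)} =
        ({X l | l. l \<in> lead_mono (grevlex lt) ` (signed_inner_minors (grevlex lt) P :: 'k pol set)} :: 'k pol set)"
      unfolding monom_pol_def by auto
    with gb show ?thesis unfolding groebner_basis_def by simp
  qed
  finally have "\<exists>l\<in>lead_mono (grevlex lt) ` (signed_inner_minors (grevlex lt) P :: 'k pol set).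
      mono_dvd l (lead_mono (grevlex lt) f)"
  proof (rule monomial_ideal_dvd)
    fix l assume "l \<in> lead_mono (grevlex lt) ` (signed_inner_minors (grevlex lt) P :: 'k pol set)"
    then show "Poly_Mapping.keys l \<subseteq> vertices P"
      using keys gb unfolding groebner_basis_def by blast
  qed simp
  then show ?thesis
    unfolding signed_inner_minors_eq using lead_mono_binomial[where 'k = 'k] by fastforce
qed

text \<open>An irreducible leading monomial would be the only monomial of its flip class in the polynomial,
  whose coefficients however sum to zero over the class. The basis is reduced because a quadratic
  monomial of a minor determines the minor.\<close>

lemma joinable_imp_reduced_groebner:
  assumes P: "polyomino P"
    and join: "\<And>m n. (flip P)\<^sup>*\<^sup>* m n \<Longrightarrow> \<exists>z. (step P lt)\<^sup>*\<^sup>* m z \<and> (step P lt)\<^sup>*\<^sup>* n z"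
  shows "reduced_groebner_basis (vertices P) (grevlex lt) (signed_inner_minors (grevlex lt) P)
    (polyomino_ideal P :: ('k::field) pol set)"
proof -
  let ?I = "polyomino_ideal P :: 'k pol set" and ?R = "poly_ring (vertices P) :: 'k pol ring"
  let ?G = "signed_inner_minors (grevlex lt) P :: 'k pol set"
    and ?lm = "lead_mono (grevlex lt) :: 'k pol \<Rightarrow> monomial"
  have lead_dvd: "\<exists>p q. lead_pair P lt p q \<and> mono_dvd (E p + E q) (?lm f)" if f: "f \<in> ?I" "f \<noteq> 0" for f
  proof (rule ccontr)
    assume irred: "\<not> ?thesis"
    let ?A = "{m \<in> Poly_Mapping.keys f. flip_class P m = flip_class P (?lm f)}"
    have no_step: "\<not> step P lt (?lm f) n" for n
    proof
      assume "step P lt (?lm f) n"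
      then obtain p q t where "lead_pair P lt p q" "?lm f = E p + E q + t"
        by (rule step_lead_pair)
      with irred show False unfolding mono_dvd_def by blast
    qed
    have "m = ?lm f" if m: "m \<in> ?A" for m
    proof (rule ccontr)
      assume ne: "m \<noteq> ?lm f"
      obtain z where z: "(step P lt)\<^sup>*\<^sup>* m z" "(step P lt)\<^sup>*\<^sup>* (?lm f) z"
        using m join[of m "?lm f"] by (auto simp: flip_class_eq_iff)
      then have "z = ?lm f"
        using no_step by (metis converse_rtranclpE)
      then have "grevlex lt (?lm f) m"
        using steps_grevlex[OF z(1)] ne by blast
      moreover have "grevlex lt m (?lm f)"
        using m ne lead_mono_max(2)[OF f(2)] by blast
      ultimately show False using grevlex_asym by blast
    qed
    then have "?A = {?lm f}"
      using lead_mono_max(1)[OF f(2)] by blast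
    then have "Poly_Mapping.lookup (push (flip_class P) f) (flip_class P (?lm f)) = Poly_Mapping.lookup f (?lm f)"
      unfolding lookup_push by simp
    moreover have "push (flip_class P) f = 0"
      using f(1) unfolding polyomino_ideal_eq by simp
    ultimately show False
      using lead_mono_max(1)[OF f(2)] by (simp add: in_keys_iff)
  qed
  have G_I: "?G \<subseteq> ?I"
    unfolding signed_inner_minors_eq lead_pair_def using binomial_in_ideal by blast
  have G_0: "0 \<notin> ?G"
  proof
    assume "0 \<in> ?G"
    then obtain p q where "lead_pair P lt p q" "(0 :: 'k pol) = binomial p q"
      unfolding signed_inner_minors_eq by blast
    with keys_binomial[where 'k = 'k] show False by (metis insert_not_empty keys_zero)
  qed
  have fin: "finite ?G"
  proof -
    have "?G \<subseteq> (\<lambda>(p, q). binomial p q) ` (vertices P \<times> vertices P)"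
      unfolding signed_inner_minors_eq lead_pair_def using box_vertices by fastforce
    then show ?thesis
      using finite_vertices[OF P] by (meson finite_SigmaI finite_imageI finite_subset)
  qed
  let ?LG = "{monom_pol (?lm g) | g. g \<in> ?G} :: 'k pol set"
    and ?LI = "{monom_pol (?lm p) | p. p \<in> ?I \<and> p \<noteq> 0} :: 'k pol set"
  have keys: "Poly_Mapping.keys (?lm g) \<subseteq> vertices P" if "g \<in> ?I" "g \<noteq> 0" for g
    using lead_mono_keys[OF that] .
  have carr: "?LI \<subseteq> carrier ?R"
    by (rule lead_monos_carrier)
  have sub: "?LG \<subseteq> ?LI" using G_I G_0 by blast
  note iG = genideal_poly_ring[OF subset_trans[OF sub carr]]
  have "?LI \<subseteq> Idl\<^bsub>?R\<^esub> ?LG"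
  proof
    fix l assume "l \<in> ?LI"
    then obtain f where f: "f \<in> ?I" "f \<noteq> 0" and l: "l = X (?lm f)" by (auto simp: monom_pol_def)
    obtain p q t where pq: "lead_pair P lt p q" and t: "?lm f = E p + E q + t"
      using lead_dvd[OF f] by (auto simp: mono_dvd_def)
    have "binomial p q \<in> ?G" unfolding signed_inner_minors_eq using pq by blast
    moreover have "X (E p + E q) = monom_pol (?lm (binomial p q))"
      by (simp only: lead_mono_binomial[OF pq] monom_pol_def)
    ultimately have "X (E p + E q) \<in> ?LG" by blast
    moreover have "X t \<in> carrier ?R"
      using keys[OF f] by (simp add: t poly_ring_carrier keys_add_nat)
    ultimately have "X t * X (E p + E q) \<in> Idl\<^bsub>?R\<^esub> ?LG"
      using iG(2) poly_ring_idealD(4)[OF iG(1)] by blast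
    then show "l \<in> Idl\<^bsub>?R\<^esub> ?LG" by (simp add: l t mult_single add.commute)
  qed
  then have "Idl\<^bsub>?R\<^esub> ?LI \<subseteq> Idl\<^bsub>?R\<^esub> ?LG"
    by (rule genideal_poly_ring_minimal[OF iG(1)])
  moreover have "Idl\<^bsub>?R\<^esub> ?LG \<subseteq> Idl\<^bsub>?R\<^esub> ?LI"
    by (rule genideal_poly_ring_minimal[OF genideal_poly_ring(1)[OF carr]])
      (rule subset_trans[OF sub genideal_poly_ring(2)[OF carr]])
  ultimately have gb: "groebner_basis (vertices P) (grevlex lt) ?G ?I"
    unfolding groebner_basis_def initial_ideal_def using fin G_I G_0 by (intro conjI equalityI)
  have "g = h" if g: "g \<in> ?G" "h \<in> ?G" and m: "m \<in> Poly_Mapping.keys h" "mono_dvd (?lm g) m" for g h m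
  proof -
    obtain p q r s where pq: "lead_pair P lt p q" "g = binomial p q" and rs: "lead_pair P lt r s"
      "h = binomial r s"
      using g unfolding signed_inner_minors_eq by blast
    have b: "box P p q" "box P r s" using pq rs by (auto simp: lead_pair_def)
    then have d: "fst p \<noteq> fst q" "snd p \<noteq> snd q" "fst r \<noteq> fst s" "snd r \<noteq> snd s"
      by (auto dest: box_distinct)
    then have "p \<noteq> q" by auto
    then have "p \<in> Poly_Mapping.keys m" "q \<in> Poly_Mapping.keys m"
      using m(2) pair_dvd_iff[of p q m] unfolding pq(2) lead_mono_binomial[OF pq(1)] by blast+
    then consider "{p, q} \<subseteq> {r, s}" | "{p, q} \<subseteq> {(fst r, snd s), (fst s, snd r)}"
      using m(1) unfolding rs(2) keys_binomial[OF rs(1)] by (auto simp: opp_def keys_add_nat)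
    then show ?thesis
    proof cases
      case 1
      with \<open>p \<noteq> q\<close> have "p = r \<and> q = s \<or> p = s \<and> q = r" by auto
      then show ?thesis by (auto simp: pq rs binomial_commute)
    next
      case 2
      with \<open>p \<noteq> q\<close> have "opp p q = E r + E s" "E p + E q = opp r s"
        by (auto simp: opp_def add.commute)
      with pq(1) rs(1) grevlex_asym show ?thesis by (auto simp: lead_pair_def)
    qed
  qed
  moreover have "lead_coeff (grevlex lt) g = 1" if "g \<in> ?G" for g
    using that lead_coeff_binomial[where 'k = 'k] unfolding signed_inner_minors_eq by blast
  ultimately show ?thesis
    unfolding reduced_groebner_basis_def using gb by blast
qed

end

section \<open>The two hypotheses in coordinates\<close>

text \<open>If two inner intervals touch in the vertex \<open>c\<close> only and lie on the diagonal that leads for the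
  unrotated order \<open><\<^sup>k\<close>, then one of the two remaining quadrants at \<open>c\<close>, cut out by the same rows
  and columns, is inner as well. The vertices \<open>p\<close> and \<open>q\<close> are the far corners.\<close>

definition bridged :: "vertex set set \<Rightarrow> nat \<Rightarrow> bool" where
  "bridged P k \<longleftrightarrow> (\<forall>p c q. xc k p < xc k c \<longrightarrow> xc k c < xc k q \<longrightarrow> yc k c < yc k p \<longrightarrow> yc k q < yc k c \<longrightarrow>
     box P p c \<longrightarrow> box P c q \<longrightarrow> box P c (fst p, snd q) \<or> box P c (fst q, snd p))"

lemma bridged_corner:
  "bridged P k \<longleftrightarrow> (\<forall>p c q. xc k p < xc k c \<longrightarrow> xc k c < xc k q \<longrightarrow> yc k c < yc k p \<longrightarrow> yc k q < yc k c \<longrightarrow>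
     box P p c \<longrightarrow> box P c q \<longrightarrow> box P c (corner k p q) \<or> box P c (corner k q p))"
proof -
  have "box P c (corner k p q) \<or> box P c (corner k q p) \<longleftrightarrow> box P c (fst p, snd q) \<or> box P c (fst q, snd p)"
    for p c q
    by (auto simp: corner_def)
  then show ?thesis by (simp only: bridged_def)
qed

text \<open>Orders of the same parity have the same leading terms, so that the condition depends on the
  parity only.\<close>

lemma bridged_transfer:
  assumes "bridged P i" and ik: "i \<in> J" "k \<in> J" "J = {1, 3, 5, 7} \<or> J = {2, 4, 6, 8}"
  shows "bridged P k"
  unfolding bridged_def
proof (intro allI impI)
  fix p c q
  assume o: "xc k p < xc k c" "xc k c < xc k q" "yc k c < yc k p" "yc k q < yc k c"
    and b: "box P p c" "box P c q"
  have "xc i p < xc i c \<and> xc i c < xc i q \<and> yc i c < yc i p \<and> yc i q < yc i c \<or>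
    xc i q < xc i c \<and> xc i c < xc i p \<and> yc i c < yc i q \<and> yc i p < yc i c"
  proof -
    have "i \<in> {1, 3, 5, 7} \<and> k \<in> {1, 3, 5, 7} \<or> i \<in> {2, 4, 6, 8} \<and> k \<in> {2, 4, 6, 8}"
      using ik by blast
    then show ?thesis
      by (elim disjE conjE insertE emptyE; use o in \<open>simp add: xc_def yc_def\<close>)
  qed
  then show "box P c (fst p, snd q) \<or> box P c (fst q, snd p)"
    using assms(1) b box_commute unfolding bridged_def by metis
qed

text \<open>For the unrotated orders, in their coordinates, leading pairs are anti-diagonal.\<close>

lemma lead_pair_unrotated:
  assumes k: "k \<in> {1..8}" and l: "lead_pair P (vertex_less k) p q"
  shows "box P p q" "xc k p < xc k q \<longleftrightarrow> yc k q < yc k p"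
proof -
  interpret vertex_order "vertex_less k" using k by (rule vertex_order_vertex_less)
  show b: "box P p q" using l by (simp add: lead_pair_def)
  then have ne: "xc k p \<noteq> xc k q" "yc k p \<noteq> yc k q" using box_iff_region[of P p q k] by blast+
  then have "p \<noteq> q" "corner k p q \<noteq> corner k q p" "{p, q} \<inter> {corner k p q, corner k q p} = {}"
    by (auto simp: vertex_eq_iff[of _ _ k])
  then have "\<exists>z\<in>{corner k p q, corner k q p}. vertex_less k z p \<and> vertex_less k z q"
    using l unfolding lead_pair_def opp_corner[of _ _ k] using grevlex_pair_iff by blast
  with ne show "xc k p < xc k q \<longleftrightarrow> yc k q < yc k p"
    by (auto simp: vertex_less_iff[OF k])
qed

lemma box_region: "box P p q \<longleftrightarrow> region P k x0 x1 y0 y1"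
  if "x0 = min (xc k p) (xc k q)" "x1 = max (xc k p) (xc k q)" "y0 = min (yc k p) (yc k q)"
    "y1 = max (yc k p) (yc k q)"
    "x0 < x1" "y0 < y1"
  using that by (subst box_iff_region[of _ _ _ k]) auto

lemma box_flip: "box P p q \<Longrightarrow> flip P (E p + E q) (opp p q)"
  unfolding flip_def by (metis add.right_neutral)

text \<open>Flipping \<open>c\<close> with \<open>p\<close> and with \<open>q\<close> in \<open>x\<^sub>p x\<^sub>c x\<^sub>q\<close> gives two monomials whose difference lies in
  the ideal. One of them is divisible by the leading term of a minor, and each anti-diagonal pair
  in either of them spans a rectangle that contains one of the two remaining quadrants.\<close>

lemma groebner_imp_bridged:
  assumes k: "k \<in> {1..8}"
    and gb: "groebner_basis (vertices P) (mono_less k) (signed_inner_minors (mono_less k) P)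
      (polyomino_ideal P :: ('k::field) pol set)"
  shows "bridged P k"
  unfolding bridged_corner
proof (intro allI impI)
  fix p c q
  assume x: "xc k p < xc k c" "xc k c < xc k q" and y: "yc k c < yc k p" "yc k q < yc k c"
    and b: "box P p c" "box P c q"
  interpret vertex_order "vertex_less k" using k by (rule vertex_order_vertex_less)
  let ?m = "corner k"
  let ?n = "opp p c + E q" and ?n' = "opp c q + E p"
  have "flip P (E p + E c + E q) ?n" "flip P (E p + E c + E q) ?n'"
    using flip_add[OF box_flip[OF b(1)], of "E q"] flip_add[OF box_flip[OF b(2)], of "E p"]
    by (simp_all only: add.assoc add.commute[of _ "E p"])
  then have "(flip P)\<^sup>*\<^sup>* ?n ?n'"
    by (meson flip_sym r_into_rtranclp rtranclp_trans)
  moreover have "Poly_Mapping.keys ?n \<subseteq> vertices P"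
    using box_vertices[OF b(1)] box_vertices(2)[OF b(2)] by (auto simp: opp_def keys_add_nat)
  ultimately have I: "X ?n - X ?n' \<in> (polyomino_ideal P :: 'k pol set)"
    by (rule flips_in_ideal)
  have kn: "Poly_Mapping.keys ?n = {?m p c, ?m c p, q}" "Poly_Mapping.keys ?n' = {?m c q, ?m q c, p}"
    by (auto simp: opp_corner[of _ _ k] keys_add_nat)
  have "q \<notin> Poly_Mapping.keys ?n'"
    unfolding kn using x y by (auto simp: vertex_eq_iff[of _ _ k])
  then have "?n \<noteq> ?n'" using kn(1) by auto
  then have "X ?n - X ?n' \<noteq> (0 :: 'k pol)"
    by (metis eq_iff_diff_eq_0 keys_single singleton_inject zero_neq_one)
  then obtain r s where rs: "lead_pair P (vertex_less k) r s"
    and dvd: "mono_dvd (E r + E s) (lead_mono (grevlex (vertex_less k)) (X ?n - X ?n' :: 'k pol))"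
    using groebner_lead_dvd[OF gb[unfolded mono_less_def] I] by blast
  let ?l = "lead_mono (grevlex (vertex_less k)) (X ?n - X ?n' :: 'k pol)"
  have "?l \<in> Poly_Mapping.keys (X ?n - X ?n' :: 'k pol)"
    using lead_mono_max(1) \<open>X ?n - X ?n' \<noteq> (0 :: 'k pol)\<close> by blast
  then have "?l = ?n \<or> ?l = ?n'"
    by (auto simp: in_keys_iff lookup_minus lookup_single when_def split: if_splits)
  moreover note lead = lead_pair_unrotated[OF k rs]
  have ne: "xc k r \<noteq> xc k s" "yc k r \<noteq> yc k s" using lead(1) box_iff_region[of P r s k] by blast+
  then have "r \<noteq> s" by auto
  then have "r \<in> Poly_Mapping.keys ?l" "s \<in> Poly_Mapping.keys ?l"
    using dvd pair_dvd_iff by blast+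
  ultimately have rs': "r \<in> {?m p c, ?m c p, q} \<and> s \<in> {?m p c, ?m c p, q} \<or>
      r \<in> {?m c q, ?m q c, p} \<and> s \<in> {?m c q, ?m q c, p}"
    using kn by metis
  have "box P (?m c p) q \<or> box P (?m p c) q \<or> box P (?m c q) p \<or> box P (?m q c) p"
    using rs' lead ne x y box_commute[of P r s] by auto
  moreover have "box P c (?m q p)" if "box P (?m c p) q"
  proof -
    have "region P k (xc k c) (xc k q) (yc k q) (yc k p)"
      using that x y by (subst (asm) box_region) auto
    then have "region P k (xc k c) (xc k q) (yc k c) (yc k p)"
      using region_glue(2)[OF y(2) y(1)] by blast
    then show ?thesis using x y by (subst box_region) auto
  qed
  moreover have "box P c (?m p q)" if "box P (?m p c) q"
  proof -
    have "region P k (xc k p) (xc k q) (yc k q) (yc k c)"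
      using that x y by (subst (asm) box_region) auto
    then have "region P k (xc k p) (xc k c) (yc k q) (yc k c)"
      using region_glue(1)[OF x] by blast
    then show ?thesis using x y by (subst box_region) auto
  qed
  moreover have "box P c (?m p q)" if "box P (?m c q) p"
  proof -
    have "region P k (xc k p) (xc k c) (yc k q) (yc k p)"
      using that x y by (subst (asm) box_region) auto
    then have "region P k (xc k p) (xc k c) (yc k q) (yc k c)"
      using region_glue(2)[OF y(2) y(1)] by blast
    then show ?thesis using x y by (subst box_region) auto
  qed
  moreover have "box P c (?m q p)" if "box P (?m q c) p"
  proof -
    have "region P k (xc k p) (xc k q) (yc k c) (yc k p)"
      using that x y by (subst (asm) box_region) auto
    then have "region P k (xc k c) (xc k q) (yc k c) (yc k p)"
      using region_glue(1)[OF x] by blast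
    then show ?thesis using x y by (subst box_region) auto
  qed
  ultimately show "box P c (?m p q) \<or> box P c (?m q p)" by blast
qed

lemma all_quadrants: "(\<forall>Y. Q Y) \<longleftrightarrow> Q LL \<and> Q LR \<and> Q UL \<and> Q UR"
  by (metis quadrant.exhaust)

lemma missing_iff:
  "missing P x0 x1 x2 y0 y1 y2 LL \<longleftrightarrow> \<not> inner_interval P (x0, y0) (x1, y1)
    \<and> inner_interval P (x1, y0) (x2, y1) \<and>
     inner_interval P (x0, y1) (x1, y2) \<and> inner_interval P (x1, y1) (x2, y2)"
  "missing P x0 x1 x2 y0 y1 y2 LR \<longleftrightarrow> \<not> inner_interval P (x1, y0) (x2, y1)
    \<and> inner_interval P (x0, y0) (x1, y1) \<and>
     inner_interval P (x0, y1) (x1, y2) \<and> inner_interval P (x1, y1) (x2, y2)"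
  "missing P x0 x1 x2 y0 y1 y2 UL \<longleftrightarrow> \<not> inner_interval P (x0, y1) (x1, y2)
    \<and> inner_interval P (x0, y0) (x1, y1) \<and>
     inner_interval P (x1, y0) (x2, y1) \<and> inner_interval P (x1, y1) (x2, y2)"
  "missing P x0 x1 x2 y0 y1 y2 UR \<longleftrightarrow> \<not> inner_interval P (x1, y1) (x2, y2)
    \<and> inner_interval P (x0, y0) (x1, y1) \<and>
     inner_interval P (x1, y0) (x2, y1) \<and> inner_interval P (x0, y1) (x1, y2)"
  by (auto simp: missing_def all_quadrants)

lemma box_inner:
  "i < i' \<Longrightarrow> j < j' \<Longrightarrow> box P (i, j) (i', j') = inner_interval P (i, j) (i', j')"
  "i < i' \<Longrightarrow> j' < j \<Longrightarrow> box P (i, j) (i', j') = inner_interval P (i, j') (i', j)"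
  "i' < i \<Longrightarrow> j < j' \<Longrightarrow> box P (i, j) (i', j') = inner_interval P (i', j) (i, j')"
  "i' < i \<Longrightarrow> j' < j \<Longrightarrow> box P (i, j) (i', j') = inner_interval P (i', j') (i, j)"
  by (simp_all add: box_def min_def max_def)

lemma pi_condI:
  assumes "x0 < x1" "x1 < x2" "y0 < y1" "y1 < y2" and miss: "miss = missing P x0 x1 x2 y0 y1 y2"
    and "i = 1 \<and> (miss LR \<and> v = (x0, y1) \<or> miss LL \<and> v = (x1, y1)) \<or>
        i = 2 \<and> (miss LL \<and> v = (x2, y1) \<or> miss LR \<and> v = (x1, y1)) \<or>
        i = 3 \<and> (miss UL \<and> v = (x2, y1) \<or> miss UR \<and> v = (x1, y1)) \<or>
        i = 4 \<and> (miss UR \<and> v = (x0, y1) \<or> miss UL \<and> v = (x1, y1)) \<or>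
        i = 5 \<and> (miss UL \<and> v = (x1, y0) \<or> miss LL \<and> v = (x1, y1)) \<or>
        i = 6 \<and> (miss UR \<and> v = (x1, y0) \<or> miss LR \<and> v = (x1, y1)) \<or>
        i = 7 \<and> (miss LR \<and> v = (x1, y2) \<or> miss UR \<and> v = (x1, y1)) \<or>
        i = 8 \<and> (miss LL \<and> v = (x1, y2) \<or> miss UL \<and> v = (x1, y1))"
  shows "pi_cond i P v"
  unfolding pi_cond_def Let_def
  by (intro exI[of _ x0] exI[of _ x1] exI[of _ x2] exI[of _ y0] exI[of _ y1] exI[of _ y2] conjI assms(1-4),
    rule assms(6)[unfolded miss])

text \<open>The conditions \<open>\<pi>\<^sub>k\<close> for the eight orders are one and the same condition in the coordinates of
  the order: \<open>a\<close>, \<open>c\<close>, \<open>b\<close> are the lower left, middle and upper right point of the grid, and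
  either the upper right quadrant is missing and \<open>v\<close> is the middle point of the left column, or
  the upper left quadrant is missing and \<open>v\<close> is the centre.\<close>

lemma pi_cond_frame:
  assumes k: "k \<in> {1..8}"
    and o: "xc k a < xc k c" "xc k c < xc k b" "yc k a < yc k c" "yc k c < yc k b"
    and m: "\<not> box P c b \<and> box P a c \<and> box P c (corner k b a) \<and> box P c (corner k a b) \<and> v = corner k a c \<or>
      \<not> box P c (corner k a b) \<and> box P a c \<and> box P c (corner k b a) \<and> box P c b \<and> v = c"
  shows "pi_cond k P v"
proof -
  obtain a1 a2 b1 b2 c1 c2 where abc: "a = (a1, a2)" "b = (b1, b2)" "c = (c1, c2)"
    by (metis surj_pair)
  have "k \<in> {1,2,3,4,5,6,7,8}" using k by auto
  then consider "k = 4" | "k = 1" | "k = 2" | "k = 3" | "k = 6" | "k = 5" | "k = 7" | "k = 8"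
    by blast
  then show ?thesis
  proof cases
    case 1
    show ?thesis
      by (rule pi_condI[of a1 c1 b1 a2 c2 b2, OF _ _ _ _ refl])
        (use 1 o m in \<open>simp_all add: abc xc_def yc_def corner_def missing_iff box_inner disj_commute conj_ac\<close>)
  next
    case 2
    show ?thesis
      by (rule pi_condI[of a1 c1 b1 b2 c2 a2, OF _ _ _ _ refl])
        (use 2 o m in \<open>simp_all add: abc xc_def yc_def corner_def missing_iff box_inner disj_commute conj_ac\<close>)
  next
    case 3
    show ?thesis
      by (rule pi_condI[of b1 c1 a1 b2 c2 a2, OF _ _ _ _ refl])
        (use 3 o m in \<open>simp_all add: abc xc_def yc_def corner_def missing_iff box_inner disj_commute conj_ac\<close>)
  next
    case 4
    show ?thesis
      by (rule pi_condI[of b1 c1 a1 a2 c2 b2, OF _ _ _ _ refl])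
        (use 4 o m in \<open>simp_all add: abc xc_def yc_def corner_def missing_iff box_inner disj_commute conj_ac\<close>)
  next
    case 5
    show ?thesis
      by (rule pi_condI[of a1 c1 b1 a2 c2 b2, OF _ _ _ _ refl])
        (use 5 o m in \<open>simp_all add: abc xc_def yc_def corner_def missing_iff box_inner disj_commute conj_ac\<close>)
  next
    case 6
    show ?thesis
      by (rule pi_condI[of b1 c1 a1 a2 c2 b2, OF _ _ _ _ refl])
        (use 6 o m in \<open>simp_all add: abc xc_def yc_def corner_def missing_iff box_inner disj_commute conj_ac\<close>)
  next
    case 7
    show ?thesis
      by (rule pi_condI[of a1 c1 b1 b2 c2 a2, OF _ _ _ _ refl])
        (use 7 o m in \<open>simp_all add: abc xc_def yc_def corner_def missing_iff box_inner disj_commute conj_ac\<close>)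
  next
    case 8
    show ?thesis
      by (rule pi_condI[of b1 c1 a1 b2 c2 a2, OF _ _ _ _ refl])
        (use 8 o m in \<open>simp_all add: abc xc_def yc_def corner_def missing_iff box_inner disj_commute conj_ac\<close>)
  qed
qed

lemma rotated_gridI:
  assumes k: "k \<in> {1..8}" and br: "bridged P k" and pi: "\<not> pi_cond k P v"
  shows "rotated_grid P k v"
proof (rule rotated_grid.intro[OF k])
  have pt: "\<exists>p. x = xc k p \<and> y = yc k p" if "x \<in> range (xc k)" "y \<in> range (yc k)" for x y
    using that by (metis imageE xc_corner yc_corner)
  have reg: "box P p q \<longleftrightarrow> region P k x0 x1 y0 y1"
    if "x0 < x1" "y0 < y1" "xc k p = x0" "xc k q = x1" "yc k p = y0 \<and> yc k q = y1 \<or> yc k p = y1 \<and> yc k q = y0"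
    for p q x0 x1 y0 y1
    using that by (intro box_region) auto
  have frame: "\<exists>a c b. xc k a = x0 \<and> yc k a = y0 \<and> xc k c = x1 \<and> yc k c = y1 \<and> xc k b = x2 \<and> yc k b = y2 \<and>
     box P a c = region P k x0 x1 y0 y1 \<and> box P c b = region P k x1 x2 y1 y2 \<and>
     box P c (corner k a b) = region P k x0 x1 y1 y2 \<and> box P c (corner k b a) = region P k x1 x2 y0 y1"
    if x: "x0 < x1" "x1 < x2" and y: "y0 < y1" "y1 < y2"
      and S: "{x0, x1, x2} \<subseteq> range (xc k)" "{y0, y1, y2} \<subseteq> range (yc k)" for x0 x1 x2 y0 y1 y2
  proof -
    obtain a c b where abc: "xc k a = x0" "yc k a = y0" "xc k c = x1" "yc k c = y1" "xc k b = x2"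
      "yc k b = y2"
      using pt[of x0 y0] pt[of x1 y1] pt[of x2 y2] S by auto
    have "box P a c = region P k x0 x1 y0 y1" "box P c b = region P k x1 x2 y1 y2"
      "box P (corner k a b) c = region P k x0 x1 y1 y2" "box P c (corner k b a) = region P k x1 x2 y0 y1"
      using x y abc by (intro reg; simp)+
    with abc show ?thesis using box_commute[of P c] by blast
  qed
  show "grid (region P k) (range (xc k)) (range (yc k)) (xc k v, yc k v)"
  proof (unfold_locales, goal_cases)
    case (4 x0 x1 x2 y0 y1 y2)
    then obtain a c b where abc: "xc k a = x0" "yc k a = y0" "xc k c = x1" "yc k c = y1" "xc k b = x2"
      "yc k b = y2"
      and r: "box P a c = region P k x0 x1 y0 y1" "box P c b = region P k x1 x2 y1 y2"
       "box P c (corner k a b) = region P k x0 x1 y1 y2" "box P c (corner k b a) = region P k x1 x2 y0 y1"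
      using frame[OF 4(1-6)] by blast
    have "box P (corner k a b) c" using r(3) 4(7) box_commute by blast
    then have "box P c (corner k (corner k a b) (corner k b a))
      \<or> box P c (corner k (corner k b a) (corner k a b))"
      using r(4) 4 abc by (intro br[unfolded bridged_corner, rule_format]) auto
    then show ?case using r(1,2) box_commute[of P a c] by simp
  next
    case (5 x0 x1 x2 y0 y1 y2)
    then obtain a c b where abc: "xc k a = x0" "yc k a = y0" "xc k c = x1" "yc k c = y1" "xc k b = x2"
      "yc k b = y2"
      and r: "box P a c = region P k x0 x1 y0 y1" "box P c b = region P k x1 x2 y1 y2"
       "box P c (corner k a b) = region P k x0 x1 y1 y2" "box P c (corner k b a) = region P k x1 x2 y0 y1"
      using frame[OF 5(1-6)] by blast
    have "v = corner k a c" using 5(7) abc by (simp add: vertex_eq_iff[of _ _ k])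
    then show ?case using pi pi_cond_frame[OF k, of a c b P v] abc r 5 by auto
  next
    case (6 x0 x1 x2 y0 y1 y2)
    then obtain a c b where abc: "xc k a = x0" "yc k a = y0" "xc k c = x1" "yc k c = y1" "xc k b = x2"
      "yc k b = y2"
      and r: "box P a c = region P k x0 x1 y0 y1" "box P c b = region P k x1 x2 y1 y2"
       "box P c (corner k a b) = region P k x0 x1 y1 y2" "box P c (corner k b a) = region P k x1 x2 y0 y1"
      using frame[OF 6(1-6)] by blast
    have "v = c" using 6(7) abc by (simp add: vertex_eq_iff[of _ _ k])
    then show ?case using pi pi_cond_frame[OF k, of a c b P v] abc r 6 by auto
  qed (use region_glue in auto)
qed

section \<open>Cancellation of variables\<close>

lemma monomial_split:
  assumes "v \<in> Poly_Mapping.keys m"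
  obtains m' :: monomial where "m = m' + E v"
proof
  show "m = (m - E v) + E v"
    using assms by (intro poly_mapping_eqI) (auto simp: lookup_add lookup_minus lookup_single when_def in_keys_iff)
qed

lemma monomial_induct [case_names zero add]:
  assumes "Q 0" "\<And>m v. Q m \<Longrightarrow> Q (m + E v)"
  shows "Q (m :: monomial)"
proof (induction "total_degree m" arbitrary: m)
  case 0
  have "Poly_Mapping.keys m = {}"
  proof (rule ccontr)
    assume "Poly_Mapping.keys m \<noteq> {}"
    then obtain v m' where "m = m' + E v" using monomial_split by blast
    with 0 show False by (simp add: total_degree_add)
  qed
  with assms(1) show ?case by simp
next
  case (Suc d)
  have "Poly_Mapping.keys m \<noteq> {}"
    using Suc.hyps(2) by (auto simp: total_degree_def)
  then obtain v where "v \<in> Poly_Mapping.keys m" by blast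
  then obtain m' where m': "m = m' + E v" by (rule monomial_split)
  with Suc have "Q m'" by (simp add: total_degree_add)
  with assms(2) m' show ?case by blast
qed

context vertex_order
begin

lemma lead_pair_least:
  assumes "lead_pair P lt p q"
  shows "\<exists>z. lt z p \<and> lt z q"
proof -
  have "fst p \<noteq> fst q" "snd p \<noteq> snd q"
    using assms box_distinct[of P p q] by (auto simp: lead_pair_def)
  then have "p \<noteq> q" "(fst p, snd q) \<noteq> (fst q, snd p)" "{p, q} \<inter> {(fst p, snd q), (fst q, snd p)} = {}"
    by (auto simp: prod_eq_iff)
  then have "\<exists>z\<in>{(fst p, snd q), (fst q, snd p)}. lt z p \<and> lt z q"
    using assms unfolding lead_pair_def opp_def by (subst (asm) grevlex_pair_iff) simp_all
  then show ?thesis by blast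
qed

end

context rotated_grid
begin

text \<open>The vertex \<open>v\<close> is the smallest one, and a leading pair never contains the smallest corner.\<close>

lemma v_not_lead:
  assumes "red p q"
  shows "p \<noteq> v" "q \<noteq> v"
proof -
  have "\<not> lt z v" for z
    using vertex_order.lt_irrefl[OF vertex_order_vertex_less[OF k]] by (simp add: rotated_def)
  then show "p \<noteq> v" "q \<noteq> v" using lead_pair_least[OF assms] by blast+
qed

lemma step_cancel_var:
  assumes "step P lt (m + E v) n"
  obtains n' where "n = n' + E v" "step P lt m n'"
proof -
  obtain p q t where pq: "red p q" and t: "m + E v = E p + E q + t" "n = opp p q + t"
    using assms by (auto simp: step_iff_red)
  have "v \<in> Poly_Mapping.keys (E p + E q + t)"
    unfolding t(1)[symmetric] by (simp add: keys_add_nat)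
  then have "v \<in> Poly_Mapping.keys t"
    using v_not_lead[OF pq] by (auto simp: keys_add_nat)
  then obtain t' where t': "t = t' + E v" by (rule monomial_split)
  then have "m + E v = (E p + E q + t') + E v" using t(1) by (simp add: add.assoc)
  then have "m = E p + E q + t'" by (rule add_right_imp_eq)
  then have "step P lt m (opp p q + t')" using red_step[OF pq] by blast
  with that t(2) t' show thesis by (metis add.assoc)
qed

lemma steps_cancel_var:
  assumes "(step P lt)\<^sup>*\<^sup>* (m + E v) n"
  shows "\<exists>n'. n = n' + E v \<and> (step P lt)\<^sup>*\<^sup>* m n'"
  using assms
proof (induction rule: rtranclp_induct)
  case (step n1 n2)
  then obtain n1' where n1': "n1 = n1' + E v" "(step P lt)\<^sup>*\<^sup>* m n1'" by blast
  with step.hyps(2) obtain n2' where "n2 = n2' + E v" "step P lt n1' n2'"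
    using step_cancel_var by blast
  with n1'(2) show ?case by (metis rtranclp.rtrancl_into_rtrancl)
qed blast

lemma steps_flips: "(step P lt)\<^sup>*\<^sup>* m n \<Longrightarrow> (flip P)\<^sup>*\<^sup>* m n"
  by (rule rtranclp_mono[THEN predicate2D]) (auto simp: step_def)

text \<open>Since \<open>x\<^sub>v\<close> occurs in no leading term, reductions of a multiple of \<open>x\<^sub>v\<close> are reductions of the
  cofactor.\<close>

lemma flips_cancel_var:
  assumes "finite (vertices P)" "(flip P)\<^sup>*\<^sup>* (m + E v) (n + E v)"
  shows "(flip P)\<^sup>*\<^sup>* m n"
proof -
  obtain z where z: "(step P lt)\<^sup>*\<^sup>* (m + E v) z" "(step P lt)\<^sup>*\<^sup>* (n + E v) z"
    using flip_joinable[OF assms] by blast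
  obtain z1 z2 where "z = z1 + E v" "(step P lt)\<^sup>*\<^sup>* m z1" "z = z2 + E v" "(step P lt)\<^sup>*\<^sup>* n z2"
    using steps_cancel_var[OF z(1)] steps_cancel_var[OF z(2)] by blast
  then have "(flip P)\<^sup>*\<^sup>* m z1" "(flip P)\<^sup>*\<^sup>* z1 n"
    using steps_flips flips_sym by auto
  then show ?thesis by (rule rtranclp_trans)
qed

end

lemma flips_cancel:
  assumes "finite (vertices P)" "\<And>v. v \<in> vertices P \<Longrightarrow> rotated_grid P (k v) v"
    and "Poly_Mapping.keys w \<subseteq> vertices P" "(flip P)\<^sup>*\<^sup>* (m + w) (n + w)"
  shows "(flip P)\<^sup>*\<^sup>* m n"
  using assms(3,4)
proof (induction w rule: monomial_induct)
  case (add w v)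
  then have v: "v \<in> vertices P" and "Poly_Mapping.keys w \<subseteq> vertices P" by (auto simp: keys_add_nat)
  moreover have "(flip P)\<^sup>*\<^sup>* (m + w) (n + w)"
    using add.prems(2) rotated_grid.flips_cancel_var[OF assms(2)[OF v] assms(1)] by (simp add: add.assoc)
  ultimately show ?case using add.IH by blast
qed simp

section \<open>Weights of monomials and primality\<close>

text \<open>The weight of a vertex in a free abelian group: a flip across the cell with upper right corner
  \<open>(Suc i, Suc j)\<close> expresses the weight of this corner by those of the other three. All other
  vertices are free generators. The generators are indexed by numbers, which orders the Laurent
  monomials linearly; hence the ring of Laurent polynomials has no zero divisors.\<close>

fun weight :: "vertex set set \<Rightarrow> nat \<Rightarrow> nat \<Rightarrow> (nat \<Rightarrow>\<^sub>0 int)" where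
  "weight P (Suc i) (Suc j) =
    (if cell (i, j) \<in> P then weight P (Suc i) j + weight P i (Suc j) - weight P i j
     else Poly_Mapping.single (prod_encode (Suc i, Suc j)) 1)"
| "weight P i j = Poly_Mapping.single (prod_encode (i, j)) 1"

text \<open>The vertices that are not the upper right corner of a cell of the collection.\<close>

definition corner_free :: "vertex set set \<Rightarrow> vertex set" where
  "corner_free P = {v \<in> vertices P. \<forall>i j. v = (Suc i, Suc j) \<longrightarrow> cell (i, j) \<notin> P}"

lemma weight_corner_free:
  assumes "v \<in> corner_free P"
  shows "weight P (fst v) (snd v) = Poly_Mapping.single (prod_encode v) 1"
  using assms by (cases v; cases "fst v"; cases "snd v") (auto simp: corner_free_def)

text \<open>The weights of opposite corners of an inner interval have the same sum, since this holds for its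
  cells.\<close>

lemma weight_box:
  assumes "inner_interval P (x0, y0) (x1, y1)"
  shows "weight P x0 y0 + weight P x1 y1 = weight P x0 y1 + weight P x1 y0"
proof -
  have x: "x0 \<le> x1" and y: "y0 \<le> y1" and c: "\<And>i j. x0 \<le> i \<Longrightarrow> i < x1 \<Longrightarrow> y0 \<le> j \<Longrightarrow> j < y1 \<Longrightarrow> cell (i, j) \<in> P"
    using assms by (auto simp: inner_interval_iff)
  have row: "weight P i (Suc j) - weight P i j = weight P x0 (Suc j) - weight P x0 j"
    if "y0 \<le> j" "j < y1" "x0 \<le> i" "i \<le> x1" for i j
    using that(3,4)
  proof (induction i rule: dec_induct)
    case (step i)
    then have "cell (i, j) \<in> P" using c that(1,2) by simp
    with step show ?case by (simp add: algebra_simps)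
  qed simp
  have "weight P x1 j - weight P x0 j = weight P x1 y0 - weight P x0 y0" if "y0 \<le> j" "j \<le> y1" for j
    using that
  proof (induction j rule: dec_induct)
    case (step j)
    then have "weight P x1 (Suc j) = weight P x0 (Suc j) - weight P x0 j + weight P x1 j"
      using row[of j x1] x by (simp add: diff_eq_eq)
    with step show ?case by simp
  qed simp
  from this[of y1] y show ?thesis by (simp add: algebra_simps)
qed

text \<open>The additive extension of the weight to monomials.\<close>

definition monomial_weight :: "vertex set set \<Rightarrow> monomial \<Rightarrow> (nat \<Rightarrow>\<^sub>0 int)" where
  "monomial_weight P m
    = (\<Sum>v\<in>Poly_Mapping.keys m. of_nat (Poly_Mapping.lookup m v) * weight P (fst v) (snd v))"

lemma monomial_weight_superset:
  assumes "finite A" "Poly_Mapping.keys m \<subseteq> A"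
  shows "monomial_weight P m = (\<Sum>v\<in>A. of_nat (Poly_Mapping.lookup m v) * weight P (fst v) (snd v))"
  unfolding monomial_weight_def using assms
  by (intro sum.mono_neutral_left) (auto simp: in_keys_iff)

lemma monomial_weight_add: "monomial_weight P (m + n) = monomial_weight P m + monomial_weight P n"
proof -
  let ?A = "Poly_Mapping.keys m \<union> Poly_Mapping.keys n"
  show ?thesis
    by (simp add: monomial_weight_superset[of ?A] keys_add_nat lookup_add distrib_right sum.distrib)
qed

lemma monomial_weight_E: "monomial_weight P (E v) = weight P (fst v) (snd v)"
  by (simp add: monomial_weight_def)

lemma monomial_weight_flip:
  assumes "flip P m n"
  shows "monomial_weight P m = monomial_weight P n"
proof -
  obtain p q t where b: "box P p q" and mn: "m = E p + E q + t" "n = opp p q + t"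
    using assms by (auto simp: flip_def)
  let ?w = "\<lambda>v. weight P (fst v) (snd v)"
  have "?w p + ?w q = ?w (fst p, snd q) + ?w (fst q, snd p)"
    using b weight_box[of P "min (fst p) (fst q)" "min (snd p) (snd q)" "max (fst p) (fst q)"
      "max (snd p) (snd q)"]
    unfolding box_def by (cases "fst p \<le> fst q"; cases "snd p \<le> snd q") (simp_all add: min_def max_def add.commute)
  then show ?thesis
    by (simp only: mn opp_def monomial_weight_add monomial_weight_E)
qed

lemma monomial_weight_flips: "(flip P)\<^sup>*\<^sup>* m n \<Longrightarrow> monomial_weight P m = monomial_weight P n"
  by (induction rule: rtranclp_induct) (auto dest: monomial_weight_flip)

lemma monomial_weight_inj:
  assumes "Poly_Mapping.keys m \<subseteq> corner_free P" "Poly_Mapping.keys n \<subseteq> corner_free P"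
    and "monomial_weight P m = monomial_weight P n"
  shows "m = n"
proof -
  have lw: "Poly_Mapping.lookup (monomial_weight P m) (prod_encode u) = int (Poly_Mapping.lookup m u)"
    if "Poly_Mapping.keys m \<subseteq> corner_free P" for m u
  proof -
    have "monomial_weight P m
      = (\<Sum>v\<in>Poly_Mapping.keys m. Poly_Mapping.single (prod_encode v) (int (Poly_Mapping.lookup m v)))"
      unfolding monomial_weight_def
    proof (rule sum.cong[OF refl])
      fix v assume "v \<in> Poly_Mapping.keys m"
      with that have "weight P (fst v) (snd v) = Poly_Mapping.single (prod_encode v) 1"
        by (intro weight_corner_free) blast
      then show "of_nat (Poly_Mapping.lookup m v) * weight P (fst v) (snd v) =
          Poly_Mapping.single (prod_encode v) (int (Poly_Mapping.lookup m v))"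
        by (simp add: mult_single flip: single_of_nat)
    qed
    then show ?thesis
      by (simp add: lookup_sum lookup_single when_def prod_encode_eq sum.delta in_keys_iff)
  qed
  show ?thesis
    using lw[OF assms(1)] lw[OF assms(2)] assms(3) by (intro poly_mapping_eqI) (metis of_nat_eq_iff)
qed

text \<open>Up to a monomial factor, every variable is flip-equivalent to a monomial without upper right
  corners.\<close>

lemma eliminate_vertex:
  "(i, j) \<in> vertices P \<Longrightarrow> \<exists>M N. Poly_Mapping.keys M \<subseteq> corner_free P \<and> Poly_Mapping.keys N \<subseteq> corner_free P \<and>
     (flip P)\<^sup>*\<^sup>* (E (i, j) + M) N"
proof (induction P i j rule: weight.induct)
  case (1 P i j)
  show ?case
  proof (cases "cell (i, j) \<in> P")
    case False
    then have "(Suc i, Suc j) \<in> corner_free P" using 1 by (simp add: corner_free_def)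
    then show ?thesis by (intro exI[of _ 0] exI[of _ "E (Suc i, Suc j)"]) simp
  next
    case True
    let ?R = "(flip P)\<^sup>*\<^sup>*"
    have V: "(i, j) \<in> vertices P" "(Suc i, j) \<in> vertices P" "(i, Suc j) \<in> vertices P"
      using UnionI[OF True] unfolding vertices_def by (simp_all add: cell_eq_corners)
    obtain Ma Na where a: "Poly_Mapping.keys Ma \<subseteq> corner_free P" "Poly_Mapping.keys Na \<subseteq> corner_free P"
      "?R (E (i, j) + Ma) Na"
      using 1 True V by blast
    obtain Mc Nc where c: "Poly_Mapping.keys Mc \<subseteq> corner_free P" "Poly_Mapping.keys Nc \<subseteq> corner_free P"
      "?R (E (i, Suc j) + Mc) Nc"
      using 1 True V by blast
    obtain Md Nd where d: "Poly_Mapping.keys Md \<subseteq> corner_free P" "Poly_Mapping.keys Nd \<subseteq> corner_free P"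
      "?R (E (Suc i, j) + Md) Nd"
      using 1 True V by blast
    have "box P (Suc i, Suc j) (i, j)"
      using True by (auto simp: box_def inner_interval_iff le_less_Suc_eq)
    then have fl: "flip P (E (Suc i, Suc j) + E (i, j)) (E (Suc i, j) + E (i, Suc j))"
      using box_flip[of P "(Suc i, Suc j)" "(i, j)"] by (simp add: opp_def)
    have "?R (Na + (E (Suc i, Suc j) + Mc + Md)) (E (i, j) + Ma + (E (Suc i, Suc j) + Mc + Md))"
      by (rule flips_add[OF flips_sym[OF a(3)]])
    also have "E (i, j) + Ma + (E (Suc i, Suc j) + Mc + Md) = E (Suc i, Suc j) + E (i, j) + (Ma + Mc + Md)"
      by (simp add: ac_simps)
    also have "?R (E (Suc i, Suc j) + E (i, j) + (Ma + Mc + Md)) (E (Suc i, j) + E (i, Suc j) + (Ma + Mc + Md))"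
      by (rule flips_add[OF r_into_rtranclp[of "flip P", OF fl]])
    also have "E (Suc i, j) + E (i, Suc j) + (Ma + Mc + Md) = E (Suc i, j) + Md + (E (i, Suc j) + Mc + Ma)"
      by (simp add: ac_simps)
    also have "?R (E (Suc i, j) + Md + (E (i, Suc j) + Mc + Ma)) (Nd + (E (i, Suc j) + Mc + Ma))"
      by (rule flips_add[OF d(3)])
    also have "Nd + (E (i, Suc j) + Mc + Ma) = E (i, Suc j) + Mc + (Ma + Nd)"
      by (simp add: ac_simps)
    also have "?R (E (i, Suc j) + Mc + (Ma + Nd)) (Nc + (Ma + Nd))"
      by (rule flips_add[OF c(3)])
    finally have "?R (E (Suc i, Suc j) + (Na + Mc + Md)) (Nc + (Ma + Nd))"
      by (simp add: ac_simps)
    with a c d show ?thesis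
      by (intro exI[of _ "Na + Mc + Md"] exI[of _ "Nc + (Ma + Nd)"]) (simp add: keys_add_nat)
  qed
next
  case ("2_1" P j)
  then have "(0, j) \<in> corner_free P" by (simp add: corner_free_def)
  then show ?case by (intro exI[of _ 0] exI[of _ "E (0, j)"]) simp
next
  case ("2_2" P i)
  then have "(i, 0) \<in> corner_free P" by (simp add: corner_free_def)
  then show ?case by (intro exI[of _ 0] exI[of _ "E (i, 0)"]) simp
qed

lemma eliminate_monomial:
  assumes "Poly_Mapping.keys m \<subseteq> vertices P"
  shows "\<exists>M N. Poly_Mapping.keys M \<subseteq> corner_free P \<and> Poly_Mapping.keys N \<subseteq> corner_free P
    \<and> (flip P)\<^sup>*\<^sup>* (m + M) N"
  using assms
proof (induction m rule: monomial_induct)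
  case zero
  show ?case by (intro exI[of _ 0]) simp
next
  case (add m v)
  then obtain M N where 1: "Poly_Mapping.keys M \<subseteq> corner_free P" "Poly_Mapping.keys N \<subseteq> corner_free P"
    "(flip P)\<^sup>*\<^sup>* (m + M) N"
    by (auto simp: keys_add_nat)
  have "v \<in> vertices P" using add.prems by (simp add: keys_add_nat)
  then obtain M' N' where 2: "Poly_Mapping.keys M' \<subseteq> corner_free P" "Poly_Mapping.keys N' \<subseteq> corner_free P"
    "(flip P)\<^sup>*\<^sup>* (E v + M') N'"
    using eliminate_vertex[of "fst v" "snd v" P] by auto
  have "(flip P)\<^sup>*\<^sup>* (m + M + (E v + M')) (N + (E v + M'))"
    using 1(3) by (rule flips_add)
  also have "(flip P)\<^sup>*\<^sup>* (N + (E v + M')) (N + N')"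
    using flips_add[OF 2(3), of N] by (simp add: add.commute)
  finally have "(flip P)\<^sup>*\<^sup>* (m + E v + (M + M')) (N + N')" by (simp add: ac_simps)
  with 1 2 show ?case
    by (intro exI[of _ "M + M'"] exI[of _ "N + N'"]) (simp add: keys_add_nat)
qed

text \<open>After multiplication with suitable monomials, both sides become monomials in the free generators
  with equal weights, hence equal; the factors are then cancelled.\<close>

lemma monomial_weight_separates:
  assumes cancel: "\<And>m n w. Poly_Mapping.keys w \<subseteq> vertices P \<Longrightarrow> (flip P)\<^sup>*\<^sup>* (m + w) (n + w) \<Longrightarrow> (flip P)\<^sup>*\<^sup>* m n"
    and mn: "Poly_Mapping.keys m \<subseteq> vertices P" "Poly_Mapping.keys n \<subseteq> vertices P"
      "monomial_weight P m = monomial_weight P n"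
  shows "(flip P)\<^sup>*\<^sup>* m n"
proof -
  obtain M N where 1: "Poly_Mapping.keys M \<subseteq> corner_free P" "Poly_Mapping.keys N \<subseteq> corner_free P"
    "(flip P)\<^sup>*\<^sup>* (m + M) N"
    using eliminate_monomial[OF mn(1)] by blast
  obtain M' N' where 2: "Poly_Mapping.keys M' \<subseteq> corner_free P" "Poly_Mapping.keys N' \<subseteq> corner_free P"
    "(flip P)\<^sup>*\<^sup>* (n + M') N'"
    using eliminate_monomial[OF mn(2)] by blast
  have "monomial_weight P N = monomial_weight P m + monomial_weight P M"
    "monomial_weight P N' = monomial_weight P n + monomial_weight P M'"
    using monomial_weight_flips[OF 1(3)] monomial_weight_flips[OF 2(3)] by (simp_all add: monomial_weight_add)
  then have "monomial_weight P (N + M') = monomial_weight P (N' + M)"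
    by (simp add: monomial_weight_add mn(3) ac_simps)
  then have N: "N + M' = N' + M"
    using 1 2 by (intro monomial_weight_inj[of _ P]) (auto simp: keys_add_nat)
  have "(flip P)\<^sup>*\<^sup>* (m + (M + M')) (N + M')"
    using flips_add[OF 1(3), of M'] by (simp add: ac_simps)
  also have "(flip P)\<^sup>*\<^sup>* (N + M') (n + (M + M'))"
    unfolding N using flips_sym[OF flips_add[OF 2(3), of M]] by (simp add: ac_simps)
  finally have "(flip P)\<^sup>*\<^sup>* (m + (M + M')) (n + (M + M'))" .
  moreover have "Poly_Mapping.keys (M + M') \<subseteq> vertices P"
    using 1(1) 2(1) by (auto simp: keys_add_nat corner_free_def)
  ultimately show ?thesis by (rule cancel[rotated])
qed

lemma polyomino_ideal_prime:
  assumes cancel: "\<And>m n w. Poly_Mapping.keys w \<subseteq> vertices P \<Longrightarrow> (flip P)\<^sup>*\<^sup>* (m + w) (n + w) \<Longrightarrow> (flip P)\<^sup>*\<^sup>* m n"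
  shows "primeideal (polyomino_ideal P :: ('k::field) pol set) (poly_ring (vertices P))"
proof -
  let ?R = "poly_ring (vertices P) :: 'k pol ring" and ?I = "polyomino_ideal P :: 'k pol set"
  have I: "f \<in> ?I \<longleftrightarrow> push (monomial_weight P) f = 0" if f: "f \<in> carrier ?R" for f
  proof -
    have class_iff: "flip_class P m = flip_class P n \<longleftrightarrow> monomial_weight P m = monomial_weight P n"
      if mn: "m \<in> Poly_Mapping.keys f" "n \<in> Poly_Mapping.keys f" for m n
      unfolding flip_class_eq_iff
    proof
      assume w: "monomial_weight P m = monomial_weight P n"
      show "(flip P)\<^sup>*\<^sup>* m n"
      proof (rule monomial_weight_separates)
        show "(flip P)\<^sup>*\<^sup>* a b" if "Poly_Mapping.keys w \<subseteq> vertices P" "(flip P)\<^sup>*\<^sup>* (a + w) (b + w)" for a b w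
          using that by (rule cancel)
      qed (use f mn w in \<open>auto simp: poly_ring_carrier\<close>)
    qed (rule monomial_weight_flips)
    have "push (flip_class P) f = 0 \<longleftrightarrow> push (monomial_weight P) f = 0"
    proof
      assume "push (flip_class P) f = 0"
      then show "push (monomial_weight P) f = 0"
        by (rule push_eq_0_factor) (simp add: class_iff)
    next
      assume "push (monomial_weight P) f = 0"
      then show "push (flip_class P) f = 0"
        by (rule push_eq_0_factor) (simp add: class_iff)
    qed
    with f show ?thesis by (simp add: polyomino_ideal_eq)
  qed
  show ?thesis
  proof (rule primeidealI[OF polyomino_ideal_ideal cring_poly_ring])
    have "push (monomial_weight P) (1 :: 'k pol) = Poly_Mapping.single (monomial_weight P 0) 1"
      by (simp flip: single_one)
    then have "push (monomial_weight P) (1 :: 'k pol) \<noteq> 0"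
      by (metis lookup_single_eq lookup_zero zero_neq_one)
    moreover have one: "1 \<in> carrier ?R" by (simp add: poly_ring_carrier)
    ultimately have "1 \<notin> ?I" using I[OF one] by blast
    with one show "carrier ?R \<noteq> ?I" by blast
  next
    fix f g assume fg: "f \<in> carrier ?R" "g \<in> carrier ?R" "f \<otimes>\<^bsub>?R\<^esub> g \<in> ?I"
    then have "push (monomial_weight P) (f * g) = 0" using I[OF poly_ring_times] by simp
    then have "push (monomial_weight P) f = 0 \<or> push (monomial_weight P) g = 0"
      by (simp add: push_times monomial_weight_add)
    with I fg show "f \<in> ?I \<or> g \<in> ?I" by blast
  qed
qed

theorem theorem2p4:
  fixes P :: "vertex set set" and J :: "nat set" and i :: nat and k :: "vertex \<Rightarrow> nat"
  assumes "polyomino P"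
    and "J = {1, 3, 5, 7} \<or> J = {2, 4, 6, 8}"
    and "i \<in> J"
    and "reduced_groebner_basis (vertices P) (mono_less i)
           (signed_inner_minors (mono_less i) P) (polyomino_ideal P :: ('k::field) pol set)"
    and "\<And>v. v \<in> vertices P \<Longrightarrow> k v \<in> J \<and> \<not> pi_cond (k v) P v"
  shows "(\<forall>v\<in>vertices P. reduced_groebner_basis (vertices P) (mono_less_at (k v) v)
           (signed_inner_minors (mono_less_at (k v) v) P) (polyomino_ideal P :: 'k pol set)) \<and>
         primeideal (polyomino_ideal P :: 'k pol set) (poly_ring (vertices P))"
proof -
  have fin: "finite (vertices P)" using assms(1) by (rule finite_vertices)
  have J: "j \<in> {1..8}" if "j \<in> J" for j using assms(2) that by auto
  have "bridged P i"
    using assms(4) unfolding reduced_groebner_basis_def by (intro groebner_imp_bridged[OF J[OF assms(3)]]) blast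
  then have grid: "rotated_grid P (k v) v" if "v \<in> vertices P" for v
    using assms(5)[OF that] J bridged_transfer[OF _ assms(3) _ assms(2)] by (intro rotated_gridI) auto
  have "reduced_groebner_basis (vertices P) (mono_less_at (k v) v)
      (signed_inner_minors (mono_less_at (k v) v) P) (polyomino_ideal P :: 'k pol set)" if "v \<in> vertices P" for v
  proof -
    interpret rotated_grid P "k v" v by (rule grid[OF that])
    show ?thesis
      unfolding mono_less_at_def using flip_joinable[OF fin]
      by (rule joinable_imp_reduced_groebner[OF assms(1)])
  qed
  moreover have "primeideal (polyomino_ideal P :: 'k pol set) (poly_ring (vertices P))"
    using flips_cancel[OF fin grid] by (rule polyomino_ideal_prime)
  ultimately show ?thesis by blast
qed

end
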